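(* Let $A=[[0_{2k+1}]]$, $B=[[0_{2l+1}]]$ with $k,l\ge 0$, and let $\Gamma$ be a linear chain. If $\Gamma\to A$, $\Gamma\to B$ is a pair of dominations, then $k=l$ and the resulting birational transformation $A\dashrightarrow B$ is equal to $\tau^s$ for some $s\in\mathbb{Z}$, where $\tau$ is the left move. In particular it is a composition of elementary transformations.
   Context: A linear chain $[[w_0,\dots,w_n]]$ is a (nonempty) path graph with linearly ordered consecutive vertices carrying integer weights $w_i=v_i^2$. Inside brackets $0_m$ denotes $m$ consecutive entries $0$. An inner blowup of a weighted graph at an edge $e$ with end points $v_0\ne v_1$ subdivides $e$ by a new vertex of weight $-1$ and decreases the weights of $v_0,v_1$ by $1$. An outer blowup at a vertex $v_0$ adds a new vertex of weight $-1$ joined to $v_0$ by one new edge and decreases the weight of $v_0$ by $1$. The inverse operations are blowdowns. A domination $\Gamma\to\Gamma'$ means that $\Gamma$ is obtained from $\Gamma'$ by a finite (possibly empty) sequence of blowups; the vertex of $\Gamma$ corresponding to a vertex $v$ of $\Gamma'$ is denoted $\hat v$, and the other vertices of $\Gamma$ are said to be contracted. A pair of dominations $\Gamma\to A$, $\Gamma\to B$ defines a birational transformation $A\dashrightarrow B$. An ordering of $\Gamma$ is fixed, and $A,B$ are ordered accordingly. Left move: for $A=[[0_{2k+1}]]$ with vertices $a_1<a_2<\dots<a_{2k+1}$, the left move $\tau:A\dashrightarrow [[0_{2k+1}]]$ is the birational transformation consisting of the outer blowup at $a_1$ (the new vertex being placed to the left of $a_1$) and the inner blowups at the edges $[a_{2i},a_{2i+1}]$,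 $i=1,\dots,k$, followed by the contraction of the vertices $\hat a_{2i+1}$, $i=0,\dots,k$. The inverse $\tau^{-1}$ is the right move. The equality $A\dashrightarrow B$ equals $\tau^s$ is understood in the sense that the iterated (left or right) move starting from $A$ produces $B$, compatibly with dominations: there is a common chain dominating $\Gamma$ and all graphs in the sequence of moves such that the dominations onto $A$ and $B$ are the given ones. Elementary transformations: let $v$ be a vertex of weight $0$ and degree $1$ or $2$. Blow up an edge joining $v$ to a neighbor $v_1$ and then blow down the proper transform of $v$; this operation and its inverse are elementary transformations (for $v$ of degree $1$ the inverse is an outer blowup at the end vertex $v$ followed by the blowdown of $v$; for the one-vertex chain $[[0]]$ the outer blowup at its vertex followed by the blowdown of that vertex is also counted as an elementary transformation). *)

theory Defs
  imports Main
begin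

record 'v wgraph =
  verts :: "'v set"
  edges :: "'v set set"
  weight :: "'v \<Rightarrow> int"

definition weighted_graph :: "'v wgraph \<Rightarrow> bool" where
  "weighted_graph G \<longleftrightarrow>
     finite (verts G) \<and> verts G \<noteq> {} \<and>
     (\<forall>d\<in>edges G. \<exists>u v. d = {u, v} \<and> u \<noteq> v \<and> u \<in> verts G \<and> v \<in> verts G)"

definition degree :: "'v wgraph \<Rightarrow> 'v \<Rightarrow> nat" where
  "degree G v = card {d \<in> edges G. v \<in> d}"

definition wgraph_iso :: "('a \<Rightarrow> 'b) \<Rightarrow> 'a wgraph \<Rightarrow> 'b wgraph \<Rightarrow> bool" where
  "wgraph_iso f G H \<longleftrightarrow>
     inj_on f (verts G) \<and> verts H = f ` verts G \<and> edges H = (\<lambda>d. f ` d) ` edges G \<and>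
     (\<forall>v\<in>verts G. weight H (f v) = weight G v)"

text \<open>\<open>linear_chain G [v\<^sub>0, \<dots>, v\<^sub>n] [w\<^sub>0, \<dots>, w\<^sub>n]\<close>: the graph \<open>G\<close>, with its vertices
  ordered as listed, is the chain \<open>[[w\<^sub>0, \<dots>, w\<^sub>n]]\<close>.\<close>

definition linear_chain :: "'v wgraph \<Rightarrow> 'v list \<Rightarrow> int list \<Rightarrow> bool" where
  "linear_chain G vs ws \<longleftrightarrow>
     vs \<noteq> [] \<and> distinct vs \<and> verts G = set vs \<and>
     edges G = {{vs ! i, vs ! Suc i} | i. Suc i < length vs} \<and>
     map (weight G) vs = ws"

text \<open>The ordering a graph on some of the vertices in \<open>ds\<close> inherits from the list \<open>ds\<close>.\<close>

definition order_on :: "'v list \<Rightarrow> 'v wgraph \<Rightarrow> 'v list" where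
  "order_on ds G = filter (\<lambda>v. v \<in> verts G) ds"

text \<open>Blowups keep the names of the old vertices; \<open>e\<close> is the new vertex.\<close>

definition inner_blowup :: "'v \<Rightarrow> 'v \<Rightarrow> 'v \<Rightarrow> 'v wgraph \<Rightarrow> 'v wgraph" where
  "inner_blowup u v e G =
     \<lparr> verts = insert e (verts G),
       edges = insert {u, e} (insert {e, v} (edges G - {{u, v}})),
       weight = (weight G)(u := weight G u - 1, v := weight G v - 1, e := -1) \<rparr>"

definition outer_blowup :: "'v \<Rightarrow> 'v \<Rightarrow> 'v wgraph \<Rightarrow> 'v wgraph" where
  "outer_blowup v e G =
     \<lparr> verts = insert e (verts G),
       edges = insert {v, e} (edges G),
       weight = (weight G)(v := weight G v - 1, e := -1) \<rparr>"

inductive blowup :: "'v wgraph \<Rightarrow> 'v wgraph \<Rightarrow> bool" where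
  inner: "\<lbrakk>weighted_graph G; {u, v} \<in> edges G; u \<noteq> v; e \<notin> verts G\<rbrakk>
            \<Longrightarrow> blowup G (inner_blowup u v e G)"
| outer: "\<lbrakk>weighted_graph G; v \<in> verts G; e \<notin> verts G\<rbrakk>
            \<Longrightarrow> blowup G (outer_blowup v e G)"

text \<open>\<open>domination \<Gamma> h A\<close> is a domination of \<open>A\<close> by \<open>\<Gamma>\<close> in which the vertex of \<open>\<Gamma>\<close> corresponding to
  a vertex \<open>v\<close> of \<open>A\<close> is \<open>h v\<close>. Where \<open>A\<close> already carries names of vertices of \<open>\<Gamma>\<close> and \<open>h\<close> is the
  inclusion, \<open>blowup\<^sup>*\<^sup>* A \<Gamma>\<close> is used instead; the contracted vertices are then
  \<open>verts \<Gamma> - verts A\<close>.\<close>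

definition domination :: "'v wgraph \<Rightarrow> ('a \<Rightarrow> 'v) \<Rightarrow> 'a wgraph \<Rightarrow> bool" where
  "domination \<Gamma> h A \<longleftrightarrow> (\<exists>A'. wgraph_iso h A A' \<and> blowup\<^sup>*\<^sup>* A' \<Gamma>)"

text \<open>\<open>left_move ds G Y G'\<close>: the pair of dominations of \<open>G\<close> and \<open>G'\<close> by \<open>Y\<close> is the left move
  of \<open>G\<close>, all three chains being ordered by \<open>ds\<close>. Lists are indexed from 0, so the vertex usually
  called \<open>a\<^sub>j\<close> is \<open>a ! (j - 1)\<close>; the new vertices are \<open>e ! 0\<close> (outer blowup) and
  \<open>e ! 1, \<dots>, e ! k\<close> (inner blowups).\<close>

definition left_move ::
    "'v list \<Rightarrow> 'v wgraph \<Rightarrow> 'v wgraph \<Rightarrow> 'v wgraph \<Rightarrow> bool" where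
  "left_move ds G Y G' \<longleftrightarrow>
     (\<exists>k a e. a = order_on ds G \<and> linear_chain G a (replicate (2 * k + 1) 0) \<and>
        length e = k + 1 \<and> distinct e \<and> set e \<inter> verts G = {} \<and>
        Y = fold (\<lambda>i. inner_blowup (a ! (2 * i - 1)) (a ! (2 * i)) (e ! i)) [1..<k + 1]
              (outer_blowup (a ! 0) (e ! 0) G) \<and>
        (\<exists>ws. linear_chain Y (order_on ds Y) ws) \<and> hd (order_on ds Y) = e ! 0 \<and>
        blowup\<^sup>*\<^sup>* G' Y \<and> verts G' = verts Y - {a ! (2 * i) | i. i \<le> k} \<and>
        linear_chain G' (order_on ds G') (replicate (2 * k + 1) 0))"

definition right_move ::
    "'v list \<Rightarrow> 'v wgraph \<Rightarrow> 'v wgraph \<Rightarrow> 'v wgraph \<Rightarrow> bool" where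
  "right_move ds G Y G' \<longleftrightarrow> left_move ds G' Y G"

text \<open>\<open>elementary G Y G'\<close>: \<open>Y\<close> is a blowup of \<open>G\<close>, and \<open>G'\<close> is obtained from \<open>Y\<close> by the
  blowdown of \<open>v\<close>.\<close>

inductive elementary :: "'v wgraph \<Rightarrow> 'v wgraph \<Rightarrow> 'v wgraph \<Rightarrow> bool" where
  edge: "\<lbrakk>weighted_graph G; v \<in> verts G; weight G v = 0; degree G v \<in> {1, 2};
          {v, v1} \<in> edges G; e \<notin> verts G; Y = inner_blowup v v1 e G;
          blowup G' Y; verts G' = verts Y - {v}\<rbrakk> \<Longrightarrow> elementary G Y G'"
| single: "\<lbrakk>linear_chain G [v] [0]; e \<notin> verts G; Y = outer_blowup v e G;
          blowup G' Y; verts G' = verts Y - {v}\<rbrakk> \<Longrightarrow> elementary G Y G'"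
| inverse: "elementary G Y G' \<Longrightarrow> elementary G' Y G"

text \<open>The birational transformation of \<open>A\<close> to \<open>B\<close> given by the dominations \<open>f\<close>, \<open>g\<close> of \<open>A\<close>, \<open>B\<close> by
  the chain \<open>\<Gamma>\<close> (ordered by \<open>gs\<close>) is the composition of \<open>n\<close> steps of the kind \<open>R\<close>: some chain
  \<open>\<Delta>\<close>, ordered by \<open>ds\<close>, dominates \<open>\<Gamma>\<close> and all graphs occurring in the steps. These graphs carry
  names of vertices of \<open>\<Delta>\<close>, so the isomorphisms \<open>f\<close> and \<open>g\<close> onto the first and the last one say
  that the induced dominations of \<open>A\<close> and \<open>B\<close> by \<open>\<Delta>\<close> are those factoring through \<open>\<Gamma>\<close>.\<close>

definition composition_of ::
    "('v list \<Rightarrow> 'v wgraph \<Rightarrow> 'v wgraph \<Rightarrow> 'v wgraph \<Rightarrow> bool) \<Rightarrow> nat \<Rightarrow>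
     'v wgraph \<Rightarrow> 'v list \<Rightarrow> ('a \<Rightarrow> 'v) \<Rightarrow> 'a wgraph \<Rightarrow> ('b \<Rightarrow> 'v) \<Rightarrow> 'b wgraph \<Rightarrow> bool" where
  "composition_of R n \<Gamma> gs f A g B \<longleftrightarrow>
     (\<exists>\<Delta> ds ws (G :: nat \<Rightarrow> 'v wgraph) (Y :: nat \<Rightarrow> 'v wgraph).
        linear_chain \<Delta> ds ws \<and> blowup\<^sup>*\<^sup>* \<Gamma> \<Delta> \<and> order_on ds \<Gamma> = gs \<and>
        wgraph_iso f A (G 0) \<and> wgraph_iso g B (G n) \<and>
        (\<forall>i\<le>n. blowup\<^sup>*\<^sup>* (G i) \<Delta>) \<and>
        (\<forall>i<n. R ds (G i) (Y i) (G (Suc i)) \<and> blowup\<^sup>*\<^sup>* (Y i) \<Delta>))"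

definition equals_move_power ::
    "int \<Rightarrow> 'v wgraph \<Rightarrow> 'v list \<Rightarrow> ('a \<Rightarrow> 'v) \<Rightarrow> 'a wgraph \<Rightarrow> ('b \<Rightarrow> 'v) \<Rightarrow> 'b wgraph \<Rightarrow> bool" where
  "equals_move_power s \<Gamma> gs f A g B \<longleftrightarrow>
     composition_of (if 0 \<le> s then left_move else right_move) (nat \<bar>s\<bar>) \<Gamma> gs f A g B"

definition composition_of_elementary ::
    "'v wgraph \<Rightarrow> 'v list \<Rightarrow> ('a \<Rightarrow> 'v) \<Rightarrow> 'a wgraph \<Rightarrow> ('b \<Rightarrow> 'v) \<Rightarrow> 'b wgraph \<Rightarrow> bool" where
  "composition_of_elementary \<Gamma> gs f A g B \<longleftrightarrow>
     (\<exists>n. composition_of (\<lambda>_. elementary) n \<Gamma> gs f A g B)"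

end

(* A chain with weights w_1, ..., w_n carries vectors r_0, ..., r_(n+1) in the plane lattice with
   r_0 = (1, 0), r_1 = (0, 1) and r_(i-1) + r_(i+1) = - w_i r_i, as for a toric surface whose
   boundary contains the chain. A blowup inserts the sum of two neighbouring vectors, also at the
   ends because of r_0 and r_(n+1). Hence the chains dominated by Gamma correspond to the subsets of
   the vectors of Gamma which it refines by regular cones. For a chain of zeros such a subset is
   forced: it consists of the multiples of r_0, which Gamma determines together with their number,
   and, between any two consecutive ones, a vector +-(x, 1). Only the integer x is free. The left
   move raises x by 1, and Gamma contains the vectors needed for all values between those of
   A and B, because a refinement of a cone into regular cones contains the sum of its generators. *)

theory Submission
  imports Defs
begin

section \<open>Rays of a chain\<close>

text \<open>The rays may turn around the origin several times, so the same vector can belong to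
  several vertices. Subdivisions are therefore sets of indices rather than of vectors, and a cone is
  a pair of indices for which all rays in between are required to lie strictly inside: determinant 1
  alone would also admit pairs separated by additional full turns. All vector geometry is expressed
  by determinants of rays; the weight of a vertex is minus the determinant of its two neighbours, so
  weight -1 says that the neighbours span a regular cone and weight 0 that they are dependent.

  A domination is a sequence of blowups of abstract graphs, so it has to be excluded that a
  dominated graph branches or that a blowdown leaves the world of subdivisions. The one vertex that
  a blowup creates decides this: its weight and its neighbours inside the larger chain determine the
  smaller graph.

  Since (x, 1) + (1, 0) = (x + 1, 1), the next value of x is reached by one mediant between each
  multiple of r_0 and the ray following it.\<close>

fun ray :: "int list \<Rightarrow> nat \<Rightarrow> int \<times> int" where
  "ray ws 0 = (1, 0)"
| "ray ws (Suc 0) = (0, 1)"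
| "ray ws (Suc (Suc i)) =
     (- (ws ! i) * fst (ray ws (Suc i)) - fst (ray ws i),
      - (ws ! i) * snd (ray ws (Suc i)) - snd (ray ws i))"

section \<open>Neighbours in a set of indices\<close>

definition consec :: "nat set \<Rightarrow> nat \<Rightarrow> nat \<Rightarrow> bool" where
  "consec S i j \<longleftrightarrow> i \<in> S \<and> j \<in> S \<and> i < j \<and> (\<forall>r\<in>S. \<not> (i < r \<and> r < j))"

definition prv :: "nat set \<Rightarrow> nat \<Rightarrow> nat" where
  "prv S i = (THE j. consec S j i)"

definition nxt :: "nat set \<Rightarrow> nat \<Rightarrow> nat" where
  "nxt S i = (THE j. consec S i j)"

lemma consec_unique_left: "consec S i j \<Longrightarrow> consec S i' j \<Longrightarrow> i = i'"
  unfolding consec_def by (metis linorder_neqE_nat)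

lemma consec_unique_right: "consec S i j \<Longrightarrow> consec S i j' \<Longrightarrow> j = j'"
  unfolding consec_def by (metis linorder_neqE_nat)

lemma prv_eq: "consec S i j \<Longrightarrow> prv S j = i"
  unfolding prv_def by (rule the_equality) (auto dest: consec_unique_left)

lemma nxt_eq: "consec S i j \<Longrightarrow> nxt S i = j"
  unfolding nxt_def by (rule the_equality) (auto dest: consec_unique_right)

lemma consec_between:
  assumes "finite S" "i \<in> S" "j \<in> S" "i < r" "r < j" "r \<notin> S"
  obtains p q where "consec S p q" "p < r" "r < q"
proof -
  let ?P = "{s \<in> S. s < r}" and ?Q = "{s \<in> S. r < s}"
  have "Max ?P \<in> ?P" by (rule Max_in) (use assms in auto)
  moreover have "Min ?Q \<in> ?Q" by (rule Min_in) (use assms in auto)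
  moreover have "\<not> (Max ?P < s \<and> s < Min ?Q)" if "s \<in> S" for s
    using that assms(1,6) by (cases s r rule: linorder_cases) (auto simp: not_less)
  ultimately show thesis
    by (intro that[of "Max ?P" "Min ?Q"]) (auto simp: consec_def)
qed

lemma consec_prev_exists:
  assumes "i \<in> S" "j \<in> S" "i < j"
  obtains p where "consec S p j"
proof -
  let ?P = "{s \<in> S. s < j}"
  have "finite ?P" by simp
  moreover have "Max ?P \<in> ?P" by (rule Max_in) (use assms in auto)
  ultimately show thesis
    using assms by (intro that[of "Max ?P"]) (auto simp: consec_def leD)
qed

lemma consec_next_exists:
  assumes "finite S" "i \<in> S" "j \<in> S" "i < j"
  obtains q where "consec S i q"
proof -
  let ?Q = "{s \<in> S. i < s}"
  have "finite ?Q" using assms by simp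
  moreover have "Min ?Q \<in> ?Q" by (rule Min_in) (use assms in auto)
  ultimately show thesis
    using assms by (intro that[of "Min ?Q"]) (auto simp: consec_def leD)
qed

text \<open>Inserting an index splits one gap and leaves every other gap alone. The same
  equivalence, read backwards, also describes the removal of a ray.\<close>

lemma consec_insert:
  assumes "consec S i j" "i < e" "e < j"
  shows "consec (insert e S) a b \<longleftrightarrow>
    consec S a b \<and> (a, b) \<noteq> (i, j) \<or> (a, b) = (i, e) \<or> (a, b) = (e, j)" (is "?L = ?R")
proof
  assume L: ?L
  then have ab: "a \<in> insert e S" "b \<in> insert e S" "a < b"
    "\<And>r. r \<in> insert e S \<Longrightarrow> \<not> (a < r \<and> r < b)"
    by (auto simp: consec_def)
  have ij: "i \<in> S" "j \<in> S" "i < j" "\<And>r. r \<in> S \<Longrightarrow> r \<le> i \<or> j \<le> r"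
    using assms(1) by (auto simp: consec_def not_less)
  consider "a = e" | "b = e" | "a \<noteq> e" "b \<noteq> e" by blast
  then show ?R
  proof cases
    case 1
    then show ?thesis using ab(2,3) ab(4)[of j] ij(4)[of b] ij assms by force
  next
    case 2
    then show ?thesis using ab(1,3) ab(4)[of i] ij(4)[of a] ij assms by force
  next
    case 3
    then show ?thesis using ab assms by (force simp: consec_def)
  qed
next
  assume R: ?R
  have ij: "i \<in> S" "j \<in> S" "i < j" "\<And>r. r \<in> S \<Longrightarrow> r \<le> i \<or> j \<le> r"
    using assms(1) by (auto simp: consec_def not_less)
  have outside: "\<not> (a < e \<and> e < b)" if c: "consec S a b" "(a, b) \<noteq> (i, j)"
  proof
    assume *: "a < e \<and> e < b"
    then have "a \<le> i" "j \<le> b" using ij(4)[of a] ij(4)[of b] c(1) assms(2,3)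
      by (auto simp: consec_def)
    moreover have "\<not> a < i" "\<not> j < b"
      using c(1) ij * assms(2,3) by (fastforce simp: consec_def)+
    ultimately show False using c(2) by auto
  qed
  have inside: "\<not> (i < r \<and> r < e)" "\<not> (e < r \<and> r < j)" if "r \<in> S" for r
    using ij(4)[OF that] assms by auto
  from R show ?L
  proof (elim disjE conjE)
    assume "consec S a b" "(a, b) \<noteq> (i, j)"
    then show ?thesis using outside unfolding consec_def by blast
  next
    assume "(a, b) = (i, e)"
    then show ?thesis using ij(1) inside(1) assms(2) unfolding consec_def by blast
  next
    assume "(a, b) = (e, j)"
    then show ?thesis using ij(2) inside(2) assms(3) unfolding consec_def by blast
  qed
qed

lemma consec_atMost: "consec {..n} i j \<longleftrightarrow> j = Suc i \<and> j \<le> n"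
proof
  assume c: "consec {..n} i j"
  then have "\<not> (i < Suc i \<and> Suc i < j)" unfolding consec_def by (auto dest: less_le_trans)
  then show "j = Suc i \<and> j \<le> n" using c by (auto simp: consec_def)
qed (auto simp: consec_def)

section \<open>Subdivisions into regular cones\<close>

locale chain =
  fixes \<Gamma> :: "'v wgraph" and gs :: "'v list" and ws :: "int list"
  assumes chain: "linear_chain \<Gamma> gs ws"
begin

text \<open>The ray of the vertex \<open>gs ! (i - 1)\<close> has the index \<open>i\<close>; the indices \<open>0\<close> and \<open>N\<close> belong to no vertex.\<close>

definition N :: nat where "N = Suc (length gs)"

definition X :: "nat \<Rightarrow> int" where "X i = fst (ray ws i)"

definition Y :: "nat \<Rightarrow> int" where "Y i = snd (ray ws i)"

definition D :: "nat \<Rightarrow> nat \<Rightarrow> int" where "D i j = X i * Y j - Y i * X j"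

text \<open>The recursion passes from one pair of neighbouring rays to the next by a matrix of
  determinant 1.\<close>

lemma D_Suc: "D i (Suc i) = 1"
proof (induction i)
  case (Suc i)
  then show ?case by (simp add: D_def X_def Y_def algebra_simps)
qed (simp add: D_def X_def Y_def)

text \<open>Note the shift: \<open>ws ! i\<close> is the weight of the vertex with ray
  \<open>Suc i\<close>.\<close>

lemma D_Suc_Suc: "D i (Suc (Suc i)) = - ws ! i"
proof -
  have "D i (Suc (Suc i)) = - ws ! i * D i (Suc i)"
    by (simp add: D_def X_def Y_def algebra_simps)
  then show ?thesis by (simp add: D_Suc)
qed

lemma D_self [simp]: "D i i = 0"
  by (simp add: D_def)

lemma D_swap: "D i j = - D j i"
  by (simp add: D_def)

lemma plucker: "D a b * D c d = D a c * D b d - D a d * D b c"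
  by (simp add: D_def algebra_simps)

text \<open>The three determinants say that ray \<open>e\<close> is the sum of the rays
  \<open>i\<close> and \<open>j\<close>; the conclusion is this sum, tested against an arbitrary ray
  \<open>r\<close>.\<close>

lemma D_mediant:
  assumes "D i j = 1" "D i e = 1" "D e j = 1"
  shows "D e r = D i r + D j r"
  using plucker[of i j e r] assms D_swap[of j e] by simp

definition cone :: "nat \<Rightarrow> nat \<Rightarrow> bool" where
  "cone i j \<longleftrightarrow> i < j \<and> D i j = 1 \<and> (\<forall>r. i < r \<and> r < j \<longrightarrow> 0 < D i r \<and> 0 < D r j)"

lemma coneD: "cone i j \<Longrightarrow> i < j" "cone i j \<Longrightarrow> D i j = 1"
  "cone i j \<Longrightarrow> i < r \<Longrightarrow> r < j \<Longrightarrow> 0 < D i r"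
  "cone i j \<Longrightarrow> i < r \<Longrightarrow> r < j \<Longrightarrow> 0 < D r j"
  by (auto simp: cone_def)

lemma cone_Suc: "cone i (Suc i)"
  by (simp add: cone_def D_Suc)

text \<open>As \<open>e\<close> is the sum of the outer rays, the determinant that is not given by
  the half-cone containing \<open>r\<close> is a sum of two determinants known to be
  positive.\<close>

lemma cone_merge:
  assumes ie: "cone i e" and ej: "cone e j" and ij: "D i j = 1"
  shows "cone i j"
proof -
  note med = D_mediant[OF ij coneD(2)[OF ie] coneD(2)[OF ej]]
  have "0 < D i r \<and> 0 < D r j" if r: "i < r" "r < j" for r
  proof (cases r e rule: linorder_cases)
    case less
    then have "0 < D i r" "0 < D r e" using r ie by (auto dest: coneD)
    then show ?thesis using med[of r] D_swap[of r e] D_swap[of r j] by linarith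
  next
    case equal
    then show ?thesis using ie ej by (simp add: coneD)
  next
    case greater
    then have "0 < D e r" "0 < D r j" using r ej by (auto dest: coneD)
    then show ?thesis using med[of r] D_swap[of r j] by linarith
  qed
  then show ?thesis using ie ej ij by (auto simp: cone_def)
qed

text \<open>In the basis \<open>i, j\<close> the ray \<open>r\<close> has the coordinates \<open>D r j, D i r\<close>; the mediant is the first
  ray at which the first coordinate no longer exceeds the second.\<close>

lemma cone_split:
  assumes c: "cone i j" and gap: "Suc i < j"
  obtains e where "i < e" "e < j" "cone i e" "cone e j"
proof -
  note ij = coneD[OF c]
  have pl: "D r j * D i s - D i r * D s j = D r s" for r s
    using plucker[of i j r s] ij D_swap[of j r] D_swap[of j s] by (simp add: algebra_simps)
  define e where "e = (LEAST r. i < r \<and> D r j \<le> D i r)"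
  have "i < j \<and> D j j \<le> D i j" using ij by simp
  then have e: "i < e" "D e j \<le> D i e" "e \<le> j"
    using LeastI[of "\<lambda>r. i < r \<and> D r j \<le> D i r" j] Least_le[of "\<lambda>r. i < r \<and> D r j \<le> D i r" j]
    by (auto simp: e_def)
  have least: "D i r < D r j" if "i < r" "r < e" for r
    using not_less_Least[of r "\<lambda>r. i < r \<and> D r j \<le> D i r"] that by (auto simp: e_def not_le)
  obtain d where d: "e = Suc d" using e(1) by (cases e) auto
  have d_pos: "0 \<le> D i d" "D i d < D d j"
  proof -
    show "0 \<le> D i d"
      using d e ij(3)[of d] by (cases "d = i") auto
    show "D i d < D d j"
      using d e ij(2) least[of d] by (cases "d = i") auto
  qed
  \<comment> \<open>At \<open>e = j\<close> the determinant of \<open>d\<close> and \<open>e\<close>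
    is the first coordinate of \<open>d\<close>. It would be 1, so the smaller second coordinate
    would vanish, which happens only for \<open>d = i\<close>, against the gap.\<close>
  have ej: "e \<noteq> j"
  proof
    assume "e = j"
    then have "D d j = 1" using pl[of d e] d D_Suc[of d] ij(2) by simp
    then show False using d_pos ij(3)[of d] d \<open>e = j\<close> gap by auto
  qed
  have pos: "0 < D e j" "0 < D i e" using ij(3,4)[of e] e ej by auto
  \<comment> \<open>The neighbours \<open>d\<close> and \<open>e\<close> satisfy
    \<open>D d j * D i e - D i d * D e j = 1\<close>. Enlarging \<open>D e j\<close> to
    \<open>D i e\<close> bounds the product by 1, while its second factor is at least 1.\<close>
  have "D i e * (D d j - D i d) \<le> 1"
  proof -
    have "D i d * D e j \<le> D i d * D i e" by (rule mult_left_mono[OF e(2) d_pos(1)])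
    then show ?thesis using pl[of d e] d D_Suc[of d] by (simp add: algebra_simps)
  qed
  moreover have "D i e * 1 \<le> D i e * (D d j - D i d)"
    by (rule mult_left_mono) (use d_pos pos in auto)
  ultimately have "D i e \<le> 1" by linarith
  then have one: "D i e = 1" "D e j = 1" using pos e(2) by linarith+
  note med = D_mediant[OF ij(2) one]
  have "0 < D r e" if "i < r" "r < e" for r
    using least[OF that] med[of r] D_swap[of r e] D_swap[of r j] by linarith
  then have "cone i e" using e ej one ij(3) by (auto simp: cone_def)
  \<comment> \<open>From here on the second coordinate stays above the first: falling back between
    two neighbouring rays would make their determinant nonpositive instead of 1.\<close>
  have after: "Suc (e + n) < j \<Longrightarrow> D (Suc (e + n)) j < D i (Suc (e + n))" for n
  proof (induction n)
    case 0
    then show ?case using D_Suc[of e] med[of "Suc e"] D_swap[of "Suc e" j] by simp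
  next
    case (Suc n)
    let ?r = "Suc (e + n)"
    have IH: "D ?r j < D i ?r" and p: "0 < D (Suc ?r) j" "0 < D ?r j"
      using Suc e ij(4) by auto
    show ?case
    proof (rule ccontr)
      assume "\<not> ?thesis"
      then have "D i (Suc ?r) \<le> D (Suc ?r) j" by simp
      then have "D ?r j * D i (Suc ?r) \<le> D ?r j * D (Suc ?r) j"
        using p by (intro mult_left_mono) auto
      also have "\<dots> \<le> D i ?r * D (Suc ?r) j"
        using p IH by (intro mult_right_mono) auto
      finally show False using pl[of ?r "Suc ?r"] D_Suc[of ?r] by simp
    qed
  qed
  have "0 < D e r" if "e < r" "r < j" for r
  proof -
    obtain n where "r = Suc (e + n)" using \<open>e < r\<close> less_iff_Suc_add by auto
    then show ?thesis using after[of n] that med[of r] D_swap[of r j] by simp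
  qed
  then have "cone e j" using e ej one ij(4) by (auto simp: cone_def)
  with \<open>cone i e\<close> show thesis using that e ej by auto
qed

definition good :: "nat set \<Rightarrow> bool" where
  "good S \<longleftrightarrow> S \<subseteq> {..N} \<and> 0 \<in> S \<and> N \<in> S \<and> (\<forall>i j. consec S i j \<longrightarrow> cone i j)"

lemma goodD: "good S \<Longrightarrow> S \<subseteq> {..N}" "good S \<Longrightarrow> 0 \<in> S" "good S \<Longrightarrow> N \<in> S" "good S \<Longrightarrow> finite S"
  "good S \<Longrightarrow> consec S i j \<Longrightarrow> cone i j"
  by (auto simp: good_def intro: finite_subset)

lemma good_full: "good {..N}"
proof -
  have "cone i j" if "consec {..N} i j" for i j
    using that by (simp add: consec_atMost cone_Suc)
  then show ?thesis by (simp add: good_def)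
qed

lemma good_insert:
  assumes "good S" "consec S i j" "cone i e" "cone e j"
  shows "good (insert e S)"
proof -
  have "i < e" "e < j" using assms by (auto dest: coneD)
  note ci = consec_insert[OF assms(2) this]
  have "j \<le> N" using assms(1,2) by (auto simp: good_def consec_def)
  then have "e \<le> N" using \<open>e < j\<close> by simp
  then show ?thesis using assms unfolding good_def ci by auto
qed

section \<open>Graphs of subdivisions\<close>

text \<open>Truncated subtraction makes \<open>nm 0\<close> equal to \<open>nm 1\<close>, so
  injectivity and the later guards are restricted to indices strictly between \<open>0\<close> and
  \<open>N\<close>.\<close>

definition nm :: "nat \<Rightarrow> 'v" where "nm i = gs ! (i - 1)"

lemma nm_inj: "inj_on nm {0<..<N}"
proof (rule inj_onI)
  fix i j assume "i \<in> {0<..<N}" "j \<in> {0<..<N}" "nm i = nm j"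
  moreover have "distinct gs" using chain by (simp add: linear_chain_def)
  ultimately have "i - 1 = j - 1" by (auto simp: nm_def N_def nth_eq_iff_index_eq)
  then show "i = j" using \<open>i \<in> _\<close> \<open>j \<in> _\<close> by auto
qed

lemma nm_eq: "0 < i \<Longrightarrow> i < N \<Longrightarrow> 0 < j \<Longrightarrow> j < N \<Longrightarrow> nm i = nm j \<longleftrightarrow> i = j"
  using nm_inj by (auto simp: inj_on_def)

text \<open>Off its vertices the weight copies that of \<Gamma>. Thus inserting a ray is literally a
  blowup, and the full set of indices gives \<Gamma> itself, without any identification of
  graphs.\<close>

definition graph :: "nat set \<Rightarrow> 'v wgraph" where
  "graph S = \<lparr> verts = nm ` (S \<inter> {0<..<N}),
     edges = {{nm i, nm j} | i j. consec S i j \<and> 0 < i \<and> j < N},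
     weight = (\<lambda>v. if v \<in> nm ` (S \<inter> {0<..<N})
        then let i = inv_into {0<..<N} nm v in - D (prv S i) (nxt S i) else weight \<Gamma> v) \<rparr>"

lemma verts_graph: "verts (graph S) = nm ` (S \<inter> {0<..<N})"
  by (simp add: graph_def)

lemma edges_graph: "edges (graph S) = {{nm i, nm j} | i j. consec S i j \<and> 0 < i \<and> j < N}"
  by (simp add: graph_def)

lemma nm_in_verts: "0 < i \<Longrightarrow> i < N \<Longrightarrow> nm i \<in> verts (graph S) \<longleftrightarrow> i \<in> S"
  using nm_inj by (auto simp: verts_graph inj_on_def)

lemma weight_graph:
  assumes "good S" "consec S i j" "consec S j l"
  shows "weight (graph S) (nm j) = - D i l"
proof -
  have j: "j \<in> S \<inter> {0<..<N}" using assms by (fastforce simp: consec_def good_def)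
  then show ?thesis using nm_inj
    by (simp add: graph_def inv_into_f_f Let_def prv_eq[OF assms(2)] nxt_eq[OF assms(3)])
qed

lemma weight_graph_outside: "v \<notin> verts (graph S) \<Longrightarrow> weight (graph S) v = weight \<Gamma> v"
  by (simp add: graph_def)

lemma good_neighbours:
  assumes "good S" "a \<in> S" "0 < a" "a < N"
  obtains p q where "consec S p a" "consec S a q"
  using assms consec_prev_exists[of 0 S a] consec_next_exists[of S a N]
  by (metis goodD(2,3,4))

lemma edge_graph_iff:
  assumes S: "S \<subseteq> {..N}" and "0 < i" "i < N" "0 < j" "j < N"
  shows "{nm i, nm j} \<in> edges (graph S) \<longleftrightarrow> consec S i j \<or> consec S j i"
proof
  assume "{nm i, nm j} \<in> edges (graph S)"
  then obtain a b where ab: "{nm i, nm j} = {nm a, nm b}" "consec S a b" "0 < a" "b < N"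
    by (auto simp: edges_graph)
  then have "a < N" "0 < b" by (auto simp: consec_def)
  with ab show "consec S i j \<or> consec S j i"
    using assms by (auto simp: doubleton_eq_iff nm_eq)
next
  assume "consec S i j \<or> consec S j i"
  then show "{nm i, nm j} \<in> edges (graph S)" using assms
    by (auto simp: edges_graph insert_commute[of "nm i"])
qed

lemma weighted_graph_graph:
  assumes "good S" "S \<inter> {0<..<N} \<noteq> {}"
  shows "weighted_graph (graph S)"
  unfolding weighted_graph_def
proof (intro conjI ballI)
  show "finite (verts (graph S))" "verts (graph S) \<noteq> {}" using assms by (auto simp: verts_graph)
  fix d assume "d \<in> edges (graph S)"
  then obtain a b where ab: "d = {nm a, nm b}" "consec S a b" "0 < a" "b < N"
    by (auto simp: edges_graph)
  then have "a < N" "0 < b" "a \<noteq> b" "a \<in> S" "b \<in> S" by (auto simp: consec_def)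
  with ab show "\<exists>u v. d = {u, v} \<and> u \<noteq> v \<and> u \<in> verts (graph S) \<and> v \<in> verts (graph S)"
    by (intro exI[of _ "nm a"] exI[of _ "nm b"]) (auto simp: nm_in_verts nm_eq)
qed

section \<open>Blowups as insertions of a ray\<close>

lemma wgraph_eqI:
  assumes "verts G = verts H" "edges G = edges H" "\<And>v. weight G v = weight H v"
  shows "(G :: 'v wgraph) = H"
  using assms by (intro wgraph.equality) auto

text \<open>The guards \<open>0 < i\<close> and \<open>j < N\<close> discard the end rays, which
  carry no vertex, so that one formula serves inner and outer blowups.\<close>

lemma weight_graph_insert:
  assumes "good S" "consec S i j" "cone i e" "cone e j"
  shows "weight (graph (insert e S)) v =
    (if 0 < e \<and> e < N \<and> v = nm e then -1
     else weight (graph S) v - (if 0 < i \<and> v = nm i \<or> j < N \<and> v = nm j then 1 else 0))"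
proof -
  let ?T = "insert e S"
  have ie: "i < e" "e < j" using assms by (auto dest: coneD)
  note ci = consec_insert[OF assms(2) ie]
  note gT = good_insert[OF assms]
  have ij: "cone i j" using assms by (auto dest: goodD)
  have eS: "e \<notin> S" using assms(2) ie by (auto simp: consec_def)
  have jN: "j \<le> N" "i \<in> S" "j \<in> S" using assms(1,2) by (auto simp: consec_def good_def)
  have iN: "i < N" "0 < e" "e < N" "0 < j" using ie jN by auto
  note med = D_mediant[OF coneD(2)[OF ij] coneD(2)[OF assms(3)] coneD(2)[OF assms(4)]]
  consider "v \<notin> verts (graph ?T)" | a where "v = nm a" "a \<in> ?T" "0 < a" "a < N"
    unfolding verts_graph image_iff by fastforce
  then show ?thesis
  proof cases
    case 1
    then have *: "v \<noteq> nm e" "0 < i \<Longrightarrow> v \<noteq> nm i" "j < N \<Longrightarrow> v \<noteq> nm j" "v \<notin> verts (graph S)"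
      using jN iN by (auto simp: verts_graph)
    then show ?thesis using weight_graph_outside[OF 1] weight_graph_outside[OF *(4)] by auto
  next
    case 2
    show ?thesis
    proof (cases "a = e")
      case True
      have "weight (graph ?T) (nm e) = - D i j"
        by (rule weight_graph[OF gT]) (auto simp: ci)
      then show ?thesis using True 2 ij coneD(2) by auto
    next
      case False
      then have "a \<in> S" using 2 by auto
      then obtain p q where pq: "consec S p a" "consec S a q"
        using good_neighbours[OF assms(1) _ 2(3,4)] by blast
      have w: "weight (graph S) v = - D p q" using weight_graph[OF assms(1) pq] 2 by simp
      have ve: "v \<noteq> nm e" using 2 iN False by (simp add: nm_eq)
      have vi: "0 < i \<and> v = nm i \<longleftrightarrow> a = i" using 2 iN by (auto simp: nm_eq)
      have vj: "j < N \<and> v = nm j \<longleftrightarrow> a = j" using 2 iN jN by (auto simp: nm_eq)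
      consider "a = i" | "a = j" | "a \<noteq> i" "a \<noteq> j" by blast
      then show ?thesis
      proof cases
        case 1
        \<comment> \<open>The weight drops by one because \<open>D p e = D p i + D p j\<close> with
          \<open>D p i = 1\<close>; the next case is the mirror image.\<close>
        then have "q = j" using pq assms(2) consec_unique_right by blast
        moreover have "(p, a) \<noteq> (i, j)" using 1 pq by (auto simp: consec_def)
        then have "weight (graph ?T) (nm a) = - D p e"
          using 1 pq by (intro weight_graph[OF gT]) (auto simp: ci)
        moreover have "D p i = 1" using pq 1 assms(1) by (auto dest!: goodD(5) coneD(2))
        ultimately show ?thesis
          using ve vi vj 1 2 w med[of p] ie D_swap[of p] by auto
      next
        case right: 2
        then have "p = i" using pq assms(2) consec_unique_left by blast
        moreover have "(a, q) \<noteq> (i, j)" using right pq ie by auto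
        then have "weight (graph ?T) (nm a) = - D e q"
          using right pq by (intro weight_graph[OF gT]) (auto simp: ci)
        moreover have "D j q = 1" using pq(2) right coneD(2) goodD(5)[OF assms(1)] by metis
        ultimately show ?thesis
          using ve vi vj 2 right w med[of q] ie by auto
      next
        case 3
        then have "weight (graph ?T) (nm a) = - D p q"
          using pq by (intro weight_graph[OF gT]) (auto simp: ci)
        then show ?thesis using ve vi vj 2 3 w by auto
      qed
    qed
  qed
qed

lemma graph_insert_inner:
  assumes "good S" "consec S i j" "cone i e" "cone e j" "0 < i" "j < N"
  shows "graph (insert e S) = inner_blowup (nm i) (nm j) (nm e) (graph S)"
proof (rule wgraph_eqI)
  have ie: "i < e" "e < j" using assms by (auto dest: coneD)
  note ci = consec_insert[OF assms(2) ie]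
  have r: "0 < e" "e < N" "i < N" "0 < j" using ie assms by auto
  show "verts (graph (insert e S)) = verts (inner_blowup (nm i) (nm j) (nm e) (graph S))"
    using r by (auto simp: verts_graph inner_blowup_def)
  show "weight (graph (insert e S)) v = weight (inner_blowup (nm i) (nm j) (nm e) (graph S)) v" for v
    using r ie assms(5,6) by (auto simp: weight_graph_insert[OF assms(1-4)] inner_blowup_def nm_eq)
  have "{nm a, nm b} \<noteq> {nm i, nm j}" if "consec S a b" "0 < a" "b < N" "(a, b) \<noteq> (i, j)" for a b
  proof -
    have "a < b" using that by (simp add: consec_def)
    then show ?thesis using that r assms ie by (auto simp: doubleton_eq_iff nm_eq)
  qed
  then have "edges (graph S) - {{nm i, nm j}} =
      {{nm a, nm b} | a b. consec S a b \<and> (a, b) \<noteq> (i, j) \<and> 0 < a \<and> b < N}"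
    unfolding edges_graph prod.inject by blast
  moreover have "edges (graph (insert e S)) = insert {nm i, nm e} (insert {nm e, nm j}
      {{nm a, nm b} | a b. consec S a b \<and> (a, b) \<noteq> (i, j) \<and> 0 < a \<and> b < N})"
    unfolding edges_graph ci prod.inject using r assms(5,6) by blast
  ultimately show
    "edges (graph (insert e S)) = edges (inner_blowup (nm i) (nm j) (nm e) (graph S))"
    by (simp add: inner_blowup_def)
qed

lemma graph_insert_left:
  assumes "good S" "consec S 0 j" "cone 0 e" "cone e j" "j < N"
  shows "graph (insert e S) = outer_blowup (nm j) (nm e) (graph S)"
proof (rule wgraph_eqI)
  have ie: "0 < e" "e < j" using assms by (auto dest: coneD)
  note ci = consec_insert[OF assms(2) ie]
  have r: "e < N" "0 < j" using ie assms by auto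
  show "verts (graph (insert e S)) = verts (outer_blowup (nm j) (nm e) (graph S))"
    using r ie by (auto simp: verts_graph outer_blowup_def)
  show "weight (graph (insert e S)) v = weight (outer_blowup (nm j) (nm e) (graph S)) v" for v
    using r ie assms(5) by (auto simp: weight_graph_insert[OF assms(1-4)] outer_blowup_def nm_eq)
  show "edges (graph (insert e S)) = edges (outer_blowup (nm j) (nm e) (graph S))"
    using r ie assms(5) by (auto simp: outer_blowup_def edges_graph ci insert_commute)
qed

lemma graph_insert_right:
  assumes "good S" "consec S i N" "cone i e" "cone e N" "0 < i"
  shows "graph (insert e S) = outer_blowup (nm i) (nm e) (graph S)"
proof (rule wgraph_eqI)
  have ie: "i < e" "e < N" using assms by (auto dest: coneD)
  note ci = consec_insert[OF assms(2) ie]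
  have r: "0 < e" "i < N" using ie assms by auto
  show "verts (graph (insert e S)) = verts (outer_blowup (nm i) (nm e) (graph S))"
    using r ie by (auto simp: verts_graph outer_blowup_def)
  show "weight (graph (insert e S)) v = weight (outer_blowup (nm i) (nm e) (graph S)) v" for v
    using r ie assms(5) by (auto simp: weight_graph_insert[OF assms(1-4)] outer_blowup_def nm_eq)
  show "edges (graph (insert e S)) = edges (outer_blowup (nm i) (nm e) (graph S))"
    using r ie assms(5) by (auto simp: outer_blowup_def edges_graph ci)
qed

lemma blowup_insert:
  assumes "good S" "consec S i j" "cone i e" "cone e j" "S \<inter> {0<..<N} \<noteq> {}"
  shows "blowup (graph S) (graph (insert e S))"
proof -
  have ie: "i < e" "e < j" using assms by (auto dest: coneD)
  have jN: "j \<le> N" "i \<in> S" "j \<in> S" "e \<notin> S" using assms(1,2) ie by (auto simp: consec_def good_def)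
  have iN: "i < N" "0 < e" "e < N" "0 < j" using ie jN by auto
  have e: "nm e \<notin> verts (graph S)" using iN jN by (simp add: nm_in_verts)
  note wg = weighted_graph_graph[OF assms(1,5)]
  consider "0 < i" "j < N" | "i = 0" "j < N" | "0 < i" "j = N" | "i = 0" "j = N"
    using jN by linarith
  then show ?thesis
  proof cases
    case 1
    have "{nm i, nm j} \<in> edges (graph S)" "nm i \<noteq> nm j"
      using 1 assms(2) iN ie by (auto simp: edges_graph nm_eq)
    then show ?thesis
      using blowup.inner[OF wg _ _ e] graph_insert_inner[OF assms(1-4) 1] by metis
  next
    case 2
    then show ?thesis
      using blowup.outer[OF wg _ e, of "nm j"] graph_insert_left[of S j e] assms iN jN nm_in_verts
      by metis
  next
    case 3
    then show ?thesis
      using blowup.outer[OF wg _ e, of "nm i"] graph_insert_right[of S i e] assms iN jN nm_in_verts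
      by metis
  next
    case 4
    then show ?thesis using assms(2,5) by (auto simp: consec_def)
  qed
qed

lemma graph_full: "graph {..N} = \<Gamma>"
proof (rule wgraph_eqI)
  have G: "verts \<Gamma> = set gs" "edges \<Gamma> = {{gs ! i, gs ! Suc i} | i. Suc i < length gs}"
    "map (weight \<Gamma>) gs = ws"
    using chain by (simp_all only: linear_chain_def)
  have "{..N} \<inter> {0<..<N} = {Suc 0..<Suc (length gs)}"
    by (auto simp: N_def)
  then have "{..N} \<inter> {0<..<N} = Suc ` {0..<length gs}"
    by (simp only: image_Suc_atLeastLessThan)
  then have "verts (graph {..N}) = (\<lambda>i. gs ! i) ` {0..<length gs}"
    by (simp add: verts_graph image_image nm_def del: image_Suc_atLeastLessThan)
  also have "\<dots> = set gs" by (metis map_nth set_map set_upt)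
  finally show "verts (graph {..N}) = verts \<Gamma>" using G by simp
  have "edges (graph {..N}) = {{nm i, nm (Suc i)} | i. 0 < i \<and> Suc i < N}"
    by (auto simp: edges_graph consec_atMost)
  also have "\<dots> = {{gs ! i, gs ! Suc i} | i. Suc i < length gs}" (is "?L = ?R")
  proof (intro set_eqI iffI)
    fix d assume "d \<in> ?L"
    then obtain i where "0 < i" "Suc i < N" "d = {nm i, nm (Suc i)}" by auto
    then have "d = {gs ! (i - 1), gs ! Suc (i - 1)}" "Suc (i - 1) < length gs"
      by (auto simp: nm_def N_def)
    then show "d \<in> ?R" by blast
  next
    fix d assume "d \<in> ?R"
    then obtain i where "Suc i < length gs" "d = {gs ! i, gs ! Suc i}" by blast
    then have "d = {nm (Suc i), nm (Suc (Suc i))}" "0 < Suc i" "Suc (Suc i) < N"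
      by (auto simp: nm_def N_def)
    then show "d \<in> ?L" by blast
  qed
  finally show "edges (graph {..N}) = edges \<Gamma>" using G by simp
  show "weight (graph {..N}) v = weight \<Gamma> v" for v
  proof (cases "v \<in> verts (graph {..N})")
    case True
    then obtain i where i: "v = nm (Suc i)" "Suc i < N"
      by (auto simp: verts_graph gr0_conv_Suc)
    have "weight (graph {..N}) (nm (Suc i)) = - D i (Suc (Suc i))"
      using i by (intro weight_graph[OF good_full]) (auto simp: consec_atMost)
    also have "\<dots> = weight \<Gamma> (nm (Suc i))"
    proof -
      have "map (weight \<Gamma>) gs ! i = weight \<Gamma> (gs ! i)" using i by (simp add: N_def)
      then show ?thesis by (simp add: D_Suc_Suc nm_def G(3))
    qed
    finally show ?thesis using i by simp
  qed (rule weight_graph_outside)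
qed

text \<open>A missing index lies inside some cone of the subdivision, and a cone with rays inside
  contains its mediant. Inserting the mediant is a blowup and leaves fewer indices missing.\<close>

lemma good_dominated:
  assumes "good S" "S \<inter> {0<..<N} \<noteq> {}"
  shows "blowup\<^sup>*\<^sup>* (graph S) \<Gamma>"
  using assms
proof (induction "card ({..N} - S)" arbitrary: S rule: less_induct)
  case less
  show ?case
  proof (cases "S = {..N}")
    case False
    then obtain r where r: "r \<le> N" "r \<notin> S" using goodD(1)[OF less(2)] by auto
    then have "r \<noteq> 0" "r \<noteq> N" using goodD(2,3)[OF less(2)] by metis+
    with r obtain i j where ij: "consec S i j" "i < r" "r < j"
      using consec_between[of S 0 N r] goodD[OF less(2)] by (metis le_neq_implies_less gr0I)
    obtain e where e: "i < e" "e < j" "cone i e" "cone e j"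
      using cone_split[OF goodD(5)[OF less(2) ij(1)]] ij by (metis Suc_lessI less_trans_Suc not_less_eq)
    have "j \<le> N" "e \<notin> S" using ij(1) e goodD(1)[OF less(2)] by (auto simp: consec_def)
    then have "e \<in> {..N} - S" using e(2) by simp
    then have "card ({..N} - S - {e}) < card ({..N} - S)"
      by (intro card_Diff1_less) auto
    then have "card ({..N} - insert e S) < card ({..N} - S)"
      by (simp only: Diff_insert[of "{..N}" e S])
    then have "blowup\<^sup>*\<^sup>* (graph (insert e S)) \<Gamma>"
      using less(1)[of "insert e S"] good_insert[OF less(2) ij(1) e(3,4)] less(3) by blast
    with blowup_insert[OF less(2) ij(1) e(3,4) less(3)] show ?thesis
      by (rule converse_rtranclp_into_rtranclp)
  qed (simp add: graph_full)
qed

end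

section \<open>Dominated chains as subdivisions\<close>

text \<open>A blowup overwrites whatever weight was stored under the name of the new vertex, so a
  blowdown determines weights on the vertices only.\<close>

definition same_graph :: "'v wgraph \<Rightarrow> 'v wgraph \<Rightarrow> bool" where
  "same_graph G H \<longleftrightarrow>
     verts G = verts H \<and> edges G = edges H \<and> (\<forall>v\<in>verts G. weight G v = weight H v)"

lemma wgraph_iso_same: "wgraph_iso f A G \<Longrightarrow> same_graph G H \<Longrightarrow> wgraph_iso f A H"
  by (auto simp: wgraph_iso_def same_graph_def)

section \<open>Recovering a graph from its blowup\<close>

lemma inner_blowup_commute:
  assumes "u \<noteq> v"
  shows "inner_blowup u v e G = inner_blowup v u e G"
proof -
  have "{u, e} = {e, u}" "{v, e} = {e, v}" "{u, v} = {v, u}" by blast+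
  then have "edges (inner_blowup u v e G) = edges (inner_blowup v u e G)"
    unfolding inner_blowup_def by (simp only: wgraph.simps insert_commute)
  moreover have "weight (inner_blowup u v e G) = weight (inner_blowup v u e G)"
    using assms by (simp add: inner_blowup_def fun_eq_iff)
  moreover have "verts (inner_blowup u v e G) = verts (inner_blowup v u e G)"
    by (simp add: inner_blowup_def)
  ultimately show ?thesis by (intro wgraph.equality) simp_all
qed

lemma edge_in_verts:
  assumes "weighted_graph G" "d \<in> edges G" "v \<in> d"
  shows "v \<in> verts G"
proof -
  obtain a b where "d = {a, b}" "a \<in> verts G" "b \<in> verts G"
    using assms(1,2) unfolding weighted_graph_def by meson
  then show ?thesis using assms(3) by auto
qed

text \<open>No old edge contains \<open>e\<close>, so the old edges are those of the blowup that
  avoid \<open>e\<close>, together with \<open>{u, v}\<close>; the weights of \<open>u\<close> and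
  \<open>v\<close> are raised again by one.\<close>

lemma inner_blowup_cancel:
  assumes G: "weighted_graph G" "{u, v} \<in> edges G" "e \<notin> verts G"
    and H: "weighted_graph H" "{u, v} \<in> edges H" "e \<notin> verts H"
    and uv: "u \<noteq> v" and same: "same_graph (inner_blowup u v e G) (inner_blowup u v e H)"
  shows "same_graph G H"
proof -
  have K: "verts K = verts (inner_blowup u v e K) - {e}"
    "edges K = insert {u, v} {d \<in> edges (inner_blowup u v e K). e \<notin> d}"
    "x \<in> verts K \<Longrightarrow>
      weight K x = weight (inner_blowup u v e K) x + (if x = u \<or> x = v then 1 else 0)"
    if "weighted_graph K" "{u, v} \<in> edges K" "e \<notin> verts K" for K x
    using that uv edge_in_verts[OF that(1)] by (auto simp: inner_blowup_def)
  have "verts G = verts H" "edges G = edges H"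
    using K(1,2)[OF G] K(1,2)[OF H] same by (auto simp: same_graph_def)
  moreover have "weight G x = weight H x" if x: "x \<in> verts G" for x
  proof -
    have "x \<in> verts H" "x \<in> verts (inner_blowup u v e G)"
      using x \<open>verts G = verts H\<close> by (auto simp: inner_blowup_def)
    then show ?thesis using K(3)[OF G x] K(3)[OF H] same by (auto simp: same_graph_def)
  qed
  ultimately show ?thesis by (simp add: same_graph_def)
qed

lemma outer_blowup_cancel:
  assumes G: "weighted_graph G" "e \<notin> verts G" and H: "weighted_graph H" "e \<notin> verts H"
    and same: "same_graph (outer_blowup v e G) (outer_blowup v e H)"
  shows "same_graph G H"
proof -
  have K: "verts K = verts (outer_blowup v e K) - {e}"
    "edges K = {d \<in> edges (outer_blowup v e K). e \<notin> d}"
    "x \<in> verts K \<Longrightarrow> weight K x = weight (outer_blowup v e K) x + (if x = v then 1 else 0)"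
    if "weighted_graph K" "e \<notin> verts K" for K x
    using that edge_in_verts[OF that(1)] by (auto simp: outer_blowup_def)
  have "verts G = verts H" "edges G = edges H"
    using K(1,2)[OF G] K(1,2)[OF H] same by (auto simp: same_graph_def)
  moreover have "weight G x = weight H x" if x: "x \<in> verts G" for x
  proof -
    have "x \<in> verts H" "x \<in> verts (outer_blowup v e G)"
      using x \<open>verts G = verts H\<close> by (auto simp: outer_blowup_def)
    then show ?thesis using K(3)[OF G x] K(3)[OF H] same by (auto simp: same_graph_def)
  qed
  ultimately show ?thesis by (simp add: same_graph_def)
qed

section \<open>Blowdowns as removals of a ray\<close>

context chain
begin

lemma remove:
  assumes T: "good T" and ie: "consec T i e" and ej: "consec T e j" and D: "D i j = 1"
  shows "good (T - {e})" "consec (T - {e}) i j" "cone i e" "cone e j" "insert e (T - {e}) = T"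
proof -
  show ce: "cone i e" "cone e j" using T ie ej by (auto dest: goodD)
  have e: "e \<in> T" "i < e" "e < j" "i \<in> T" "j \<in> T" using ie ej by (auto simp: consec_def)
  then show ins: "insert e (T - {e}) = T" by auto
  have "\<not> (i < r \<and> r < j)" if "r \<in> T - {e}" for r
    using that ie ej unfolding consec_def by (metis DiffD1 DiffD2 insertI1 linorder_neqE_nat)
  then show ij: "consec (T - {e}) i j" using e by (auto simp: consec_def)
  have "cone a b" if ab: "consec (T - {e}) a b" for a b
  proof (cases "(a, b) = (i, j)")
    case True
    then show ?thesis using cone_merge[OF ce D] by simp
  next
    case False
    then have "consec T a b" using consec_insert[OF ij e(2,3), of a b] ab ins by simp
    then show ?thesis using goodD(5)[OF T] by blast
  qed
  moreover have "e \<noteq> 0" "j \<le> N" using e goodD(1)[OF T] by auto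
  ultimately show "good (T - {e})" using T e by (auto simp: good_def)
qed

text \<open>The new vertex has weight -1, so its ray may be removed from \<open>T\<close>. What
  remains has the same blowup as \<open>G\<close>, and cancellation identifies the two.\<close>

lemma good_blowdown:
  assumes "blowup G G'" "good T" "same_graph G' (graph T)"
  shows "\<exists>S. good S \<and> same_graph G (graph S)"
proof -
  \<comment> \<open>Both kinds of blowup use this: a vertex of weight -1 can only be adjacent to its
    neighbours along the chain, and an end ray supplies no neighbour.\<close>
  have nbrs: "\<exists>e i j. e' = nm e \<and> 0 < e \<and> e < N \<and> consec T i e \<and> consec T e j \<and> D i j = 1 \<and>
      (\<forall>v. {v, e'} \<in> edges (graph T) \<longrightarrow> v = nm i \<and> 0 < i \<or> v = nm j \<and> j < N)"
    if e': "e' \<in> verts (graph T)" "weight (graph T) e' = -1" for e'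
  proof -
    obtain e where e: "e' = nm e" "e \<in> T" "0 < e" "e < N" using e' by (auto simp: verts_graph)
    obtain i j where ij: "consec T i e" "consec T e j"
      using good_neighbours[OF assms(2) e(2-4)] by blast
    have "D i j = 1" using weight_graph[OF assms(2) ij] e e' by simp
    moreover have "v = nm i \<and> 0 < i \<or> v = nm j \<and> j < N" if v: "{v, e'} \<in> edges (graph T)" for v
    proof -
      have "weighted_graph (graph T)" using assms(2) e by (intro weighted_graph_graph) auto
      then have "v \<in> verts (graph T)" using v by (auto dest: edge_in_verts)
      then obtain a where a: "v = nm a" "a \<in> T" "0 < a" "a < N" by (auto simp: verts_graph)
      then have "consec T a e \<or> consec T e a"
        using v e edge_graph_iff[OF goodD(1)[OF assms(2)]] by blast
      then have "a = i \<or> a = j" using ij consec_unique_left consec_unique_right by blast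
      then show ?thesis using a by auto
    qed
    ultimately show ?thesis using e ij by blast
  qed
  from assms(1) show ?thesis
  proof cases
    case (inner u v e')
    have "e' \<in> verts (graph T)" "weight (graph T) e' = -1"
      "{u, e'} \<in> edges (graph T)" "{v, e'} \<in> edges (graph T)"
      using assms(3) inner by (auto simp: same_graph_def inner_blowup_def insert_commute)
    then obtain e i j where e: "e' = nm e" "0 < e" "e < N" "consec T i e" "consec T e j" "D i j = 1"
      "u = nm i \<and> 0 < i \<or> u = nm j \<and> j < N" "v = nm i \<and> 0 < i \<or> v = nm j \<and> j < N"
      using nbrs by blast
    note rm = remove[OF assms(2) e(4-6)]
    have ij: "0 < i" "j < N" using e inner by auto
    have eq: "graph T = inner_blowup (nm i) (nm j) e' (graph (T - {e}))"
      using graph_insert_inner[OF rm(1-4) ij] rm(5) e by simp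
    have edge: "{nm i, nm j} \<in> edges (graph (T - {e}))" using rm(2) ij by (auto simp: edges_graph)
    have "i \<in> T - {e}" "i < N" using rm(2) ij by (auto simp: consec_def)
    then have wg: "weighted_graph (graph (T - {e}))"
      using ij by (intro weighted_graph_graph[OF rm(1)]) auto
    have en: "e' \<notin> verts (graph (T - {e}))" using e by (simp add: nm_in_verts)
    have uv: "u = nm i \<and> v = nm j \<or> u = nm j \<and> v = nm i" using e inner by auto
    then have "G' = inner_blowup (nm i) (nm j) e' G" "{nm i, nm j} \<in> edges G" "nm i \<noteq> nm j"
      using inner inner_blowup_commute[of u v] by (auto simp: insert_commute)
    then have "same_graph G (graph (T - {e}))"
      using inner_blowup_cancel[OF inner(2) _ _ wg edge en] assms(3) inner eq by metis
    then show ?thesis using rm(1) by blast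
  next
    case (outer v e')
    have E: "e' \<in> verts (graph T)" "weight (graph T) e' = -1"
      "edges (graph T) = insert {v, e'} (edges G)"
      using assms(3) outer by (auto simp: same_graph_def outer_blowup_def)
    have only: "u = v" if "{u, e'} \<in> edges (graph T)" for u
    proof -
      have "{u, e'} \<notin> edges G" using edge_in_verts[OF outer(2), of "{u, e'}" e'] outer(4) by auto
      then have "{u, e'} = {v, e'}" using that E(3) by simp
      then show ?thesis by (auto simp: doubleton_eq_iff)
    qed
    have "{v, e'} \<in> edges (graph T)" using E(3) by simp
    then obtain e i j where e: "e' = nm e" "0 < e" "e < N" "consec T i e" "consec T e j" "D i j = 1"
      "v = nm i \<and> 0 < i \<or> v = nm j \<and> j < N"
      using nbrs[OF E(1,2)] by blast
    note rm = remove[OF assms(2) e(4-6)]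
    have i: "i \<in> T - {e}" "i < N" "j \<in> T - {e}" "0 < j" "i < j" "j \<le> N"
      using rm(2) e goodD(1)[OF assms(2)] by (auto simp: consec_def)
    \<comment> \<open>The new vertex of an outer blowup lies on a single edge, so it cannot have
      vertices on both sides. Hence it is an end of the chain and no branching occurs.\<close>
    have ends: "i = 0 \<or> j = N"
    proof (rule ccontr)
      assume *: "\<not> ?thesis"
      then have "{nm i, e'} \<in> edges (graph T)" "{nm j, e'} \<in> edges (graph T)"
        using e i edge_graph_iff[OF goodD(1)[OF assms(2)]] by auto
      then have "nm i = nm j" using only by metis
      then show False using * i by (simp add: nm_eq)
    qed
    have eq: "graph T = outer_blowup v e' (graph (T - {e}))"
    proof (cases "v = nm i \<and> 0 < i")
      case True
      then have "j = N" using ends by simp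
      then show ?thesis using graph_insert_right[OF rm(1) _ rm(3)] rm e True by simp
    next
      case False
      then have v: "v = nm j" "j < N" using e by auto
      then have "i = 0" using ends by simp
      then show ?thesis using graph_insert_left[OF rm(1) _ _ rm(4) v(2)] rm e v by simp
    qed
    have "(T - {e}) \<inter> {0<..<N} \<noteq> {}" using e(7) i by auto
    then have wg: "weighted_graph (graph (T - {e}))" by (rule weighted_graph_graph[OF rm(1)])
    have en: "e' \<notin> verts (graph (T - {e}))" using e by (simp add: nm_in_verts)
    have "same_graph G (graph (T - {e}))"
      using outer_blowup_cancel[OF outer(2,4) wg en] assms(3) outer eq by metis
    then show ?thesis using rm(1) by blast
  qed
qed

lemma dominated_good:
  assumes "blowup\<^sup>*\<^sup>* G \<Gamma>"
  shows "\<exists>S. good S \<and> same_graph G (graph S)"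
  using assms
proof (induction rule: converse_rtranclp_induct)
  case base
  then show ?case using good_full graph_full by (metis same_graph_def)
next
  case (step G G')
  then show ?case using good_blowdown by blast
qed

end

section \<open>Zero chains\<close>

text \<open>Bounded, because the enumerations \<open>z\<close> and \<open>w\<close> of a zero chain
  are constrained only up to \<open>Suc k\<close> and \<open>k\<close>.\<close>

lemma bounded_strict_mono:
  fixes f :: "nat \<Rightarrow> nat"
  assumes "\<And>i. i < n \<Longrightarrow> f i < f (Suc i)" "i < j" "j \<le> n"
  shows "f i < f j"
  using assms(2,3)
proof (induction j)
  case (Suc j)
  then show ?case using assms(1)[of j] by (cases "i = j") (auto intro: less_trans)
qed simp

lemma bounded_strict_mono_list:
  fixes f :: "nat \<Rightarrow> nat"
  assumes "\<And>i. i < n \<Longrightarrow> f i < f (Suc i)"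
  shows "sorted (map f [0..<Suc n])" "distinct (map f [0..<Suc n])"
proof -
  have lt: "f i < f j" if "i < j" "j \<le> n" for i j
    by (rule bounded_strict_mono[of n f, OF assms that])
  have "f i \<noteq> f j" if "i \<le> n" "j \<le> n" "i \<noteq> j" for i j
    using lt[of i j] lt[of j i] that by (cases i j rule: linorder_cases) auto
  then have "inj_on f {0..<Suc n}"
    unfolding inj_on_def by (metis atLeastLessThan_iff less_Suc_eq_le)
  then show "distinct (map f [0..<Suc n])" by (simp only: distinct_map set_upt distinct_upt)
  show "sorted (map f [0..<Suc n])"
    unfolding sorted_iff_nth_mono_less
    using lt by (auto simp del: upt_Suc intro!: less_imp_le)
qed

lemma bounded_strict_mono_unique:
  fixes f g :: "nat \<Rightarrow> nat"
  assumes f: "\<And>i. i < n \<Longrightarrow> f i < f (Suc i)" and g: "\<And>i. i < n \<Longrightarrow> g i < g (Suc i)"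
    and eq: "f ` {..n} = g ` {..n}" and "i \<le> n"
  shows "f i = g i"
proof -
  have "set (map f [0..<Suc n]) = set (map g [0..<Suc n])"
    using eq by (simp only: set_map set_upt atLeast0LessThan lessThan_Suc_atMost)
  then have "map f [0..<Suc n] = map g [0..<Suc n]"
    using bounded_strict_mono_list f g by (intro sorted_distinct_set_unique) blast+
  then show ?thesis
    using \<open>i \<le> n\<close> by (metis (no_types) map_eq_conv set_upt atLeastLessThan_iff le_imp_less_Suc le0)
qed

lemma consec_sorted_list:
  assumes "finite S" "Suc j < card S"
  shows "consec S (sorted_list_of_set S ! j) (sorted_list_of_set S ! Suc j)"
proof -
  let ?L = "sorted_list_of_set S"
  have L: "length ?L = card S" "sorted ?L" "distinct ?L" "set ?L = S"
    "sorted_wrt (<) ?L"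
    using assms by auto
  have "\<not> (?L ! j < r \<and> r < ?L ! Suc j)" if "r \<in> S" for r
  proof
    assume r: "?L ! j < r \<and> r < ?L ! Suc j"
    obtain i where i: "i < card S" "r = ?L ! i" using \<open>r \<in> S\<close> L by (metis in_set_conv_nth)
    have "?L ! i \<le> ?L ! j \<or> ?L ! Suc j \<le> ?L ! i"
      using sorted_nth_mono[OF L(2), of i j] sorted_nth_mono[OF L(2), of "Suc j" i] i assms L(1)
      by (cases "i \<le> j") auto
    then show False using r i by auto
  qed
  moreover have "?L ! j < ?L ! Suc j"
    using L(1,5) assms by (simp add: sorted_wrt_iff_nth_less)
  moreover have "?L ! j \<in> S" "?L ! Suc j \<in> S" using L assms by (metis Suc_lessD nth_mem)+
  ultimately show ?thesis by (simp add: consec_def)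
qed

text \<open>For increasing interleaved enumerations these are \<open>2 * k + 3\<close> indices;
  without the ends \<open>z 0\<close> and \<open>z (Suc k)\<close> there remain the
  \<open>2 * k + 1\<close> vertices.\<close>

definition alternate :: "nat \<Rightarrow> (nat \<Rightarrow> nat) \<Rightarrow> (nat \<Rightarrow> nat) \<Rightarrow> nat set" where
  "alternate k z w = z ` {..Suc k} \<union> w ` {..k}"

context chain
begin

text \<open>The rays of a zero chain alternate between \<open>\<plusminus>(1, 0)\<close> and \<open>\<plusminus>(x, 1)\<close>.\<close>

definition zero_fan :: "nat \<Rightarrow> int \<Rightarrow> (nat \<Rightarrow> nat) \<Rightarrow> (nat \<Rightarrow> nat) \<Rightarrow> bool" where
  "zero_fan k x z w \<longleftrightarrow> z 0 = 0 \<and> z (Suc k) = N \<and>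
     (\<forall>i\<le>k. cone (z i) (w i) \<and> cone (w i) (z (Suc i)) \<and> X (w i) = (-1) ^ i * x \<and> Y (w i) = (-1) ^ i) \<and>
     (\<forall>i\<le>Suc k. X (z i) = (-1) ^ i \<and> Y (z i) = 0)"

lemma zero_fanD:
  assumes "zero_fan k x z w"
  shows "z 0 = 0" "z (Suc k) = N"
    "i \<le> k \<Longrightarrow> cone (z i) (w i)" "i \<le> k \<Longrightarrow> cone (w i) (z (Suc i))"
    "i \<le> k \<Longrightarrow> X (w i) = (-1) ^ i * x" "i \<le> k \<Longrightarrow> Y (w i) = (-1) ^ i"
    "i \<le> Suc k \<Longrightarrow> X (z i) = (-1) ^ i" "i \<le> Suc k \<Longrightarrow> Y (z i) = 0"
    "i \<le> k \<Longrightarrow> z i < w i" "i \<le> k \<Longrightarrow> w i < z (Suc i)"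
  using assms by (auto simp: zero_fan_def dest: coneD(1))

lemma zero_fan_less:
  assumes "zero_fan k x z w" "i < j" "j \<le> Suc k"
  shows "z i < z j"
proof (rule bounded_strict_mono[of "Suc k" z, OF _ assms(2,3)])
  show "z i < z (Suc i)" if "i < Suc k" for i
    using zero_fanD(9,10)[OF assms(1), of i] that by simp
qed

lemma zero_fan_le:
  assumes "zero_fan k x z w" "i \<le> j" "j \<le> Suc k"
  shows "z i \<le> z j"
  using zero_fan_less[OF assms(1)] assms(2,3) by (cases "i = j") (auto simp: less_imp_le)

lemma zero_fan_block:
  assumes "zero_fan k x z w" "r < N"
  obtains i where "i \<le> k" "z i \<le> r" "r < z (Suc i)"
proof -
  have "\<exists>i\<le>n. z i \<le> r \<and> r < z (Suc i)" if "r < z (Suc n)" for n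
    using that
  proof (induction n)
    case 0
    then show ?case using zero_fanD(1)[OF assms(1)] by simp
  next
    case (Suc n)
    then show ?case by (cases "r < z (Suc n)") (auto intro: le_SucI simp: not_less)
  qed
  then show thesis using that assms(2) zero_fanD(2)[OF assms(1)] by metis
qed

lemma same_block:
  assumes "zero_fan k x z w" "i \<le> k" "j \<le> k" "z i < r" "r < z (Suc i)" "z j < r" "r < z (Suc j)"
  shows "i = j"
proof (rule ccontr)
  assume "i \<noteq> j"
  then have "Suc i \<le> j \<or> Suc j \<le> i" by auto
  then have "z (Suc i) \<le> z j \<or> z (Suc j) \<le> z i" using zero_fan_le[OF assms(1)] assms(2,3) by auto
  then show False using assms by auto
qed

text \<open>This describes the set of all \<open>z i\<close> by \<Gamma> alone. A ray inside one of
  the cones has nonzero determinant with a multiple of (1, 0), hence a nonzero second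
  coordinate.\<close>

lemma zero_fan_Y_zero:
  assumes zf: "zero_fan k x z w"
  shows "{r. r \<le> N \<and> Y r = 0} = z ` {..Suc k}"
proof (intro set_eqI iffI)
  fix r assume "r \<in> z ` {..Suc k}"
  then show "r \<in> {r. r \<le> N \<and> Y r = 0}"
    using zero_fanD(2,8)[OF zf] zero_fan_le[OF zf, of _ "Suc k"] by auto
next
  fix r assume r: "r \<in> {r. r \<le> N \<and> Y r = 0}"
  show "r \<in> z ` {..Suc k}"
  proof (cases "r = N")
    case True
    then show ?thesis using zero_fanD(2)[OF zf] by (metis atMost_iff imageI le_refl)
  next
    case False
    then obtain i where i: "i \<le> k" "z i \<le> r" "r < z (Suc i)"
      using zero_fan_block[OF zf, of r] r by auto
    have "r = z i"
    proof (rule ccontr)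
      assume "r \<noteq> z i"
      then consider "z i < r" "r < w i" | "r = w i" | "w i < r" "r < z (Suc i)"
        using i by linarith
      then show False
      proof cases
        case 1
        then have "0 < D (z i) r" using zero_fanD(3)[OF zf i(1)] coneD(3) by blast
        then show False using r i zero_fanD(8)[OF zf, of i] by (simp add: D_def)
      next
        case 2
        then show False using r i zero_fanD(6)[OF zf, of i] by simp
      next
        case 3
        then have "0 < D r (z (Suc i))" using zero_fanD(4)[OF zf i(1)] coneD(4) by blast
        then show False using r i zero_fanD(8)[OF zf, of "Suc i"] by (simp add: D_def)
      qed
    qed
    then show ?thesis using i by auto
  qed
qed

text \<open>Both enumerations list the zeros of \<open>Y\<close> in increasing order.\<close>

lemma zero_fan_unique:
  assumes "zero_fan k x z w" "zero_fan l y z' w'"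
  shows "k = l" "i \<le> Suc k \<Longrightarrow> z i = z' i"
proof -
  have less: "z i < z (Suc i)" if "i < Suc k" "zero_fan k x z w" for i k x z w
    using zero_fan_less[OF that(2), of i "Suc i"] that(1) by simp
  have card: "card (z ` {..Suc k}) = Suc (Suc k)" if zf: "zero_fan k x z w" for k x z w
  proof -
    have "z i \<noteq> z j" if "i \<le> Suc k" "j \<le> Suc k" "i \<noteq> j" for i j
      using zero_fan_less[OF zf] that by (cases i j rule: linorder_cases) (metis less_irrefl)+
    then have "inj_on z {..Suc k}" by (auto simp: inj_on_def)
    then show ?thesis by (simp add: card_image)
  qed
  have eq: "z ` {..Suc k} = z' ` {..Suc l}"
    using zero_fan_Y_zero assms by metis
  then show kl: "k = l" using card[OF assms(1)] card[OF assms(2)] by simp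
  show "z i = z' i" if "i \<le> Suc k"
    using bounded_strict_mono_unique[of "Suc k" z z' i] less[OF _ assms(1)] less[OF _ assms(2)] kl eq that
    by metis
qed

lemma sign_sq: "(-1) ^ i * (-1) ^ i = (1 :: int)"
  by (simp flip: power_mult_distrib)

text \<open>The common sign \<open>(-1) ^ i\<close> cancels. Inside a block the ray with the larger
  parameter therefore comes first.\<close>

lemma zero_fan_D:
  assumes "zero_fan k x z w" "zero_fan k y z' w'" "i \<le> k"
  shows "D (w i) (w' i) = x - y"
proof -
  have "D (w i) (w' i) = ((-1) ^ i * (-1) ^ i) * (x - y)"
    unfolding D_def zero_fanD(5,6)[OF assms(1,3)] zero_fanD(5,6)[OF assms(2,3)]
    by (simp only: algebra_simps)
  then show ?thesis unfolding sign_sq by simp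
qed

lemma zero_fan_same:
  assumes "zero_fan k x z w" "zero_fan k x z w'"
  shows "alternate k z w = alternate k z w'"
proof -
  have "\<not> w i < w' i" if "zero_fan k x z w" "zero_fan k x z w'" "i \<le> k" for i w w'
  proof
    assume "w i < w' i"
    then have "0 < D (w i) (w' i)" using coneD(3)[of "w i" "z (Suc i)"] zero_fanD[OF that(1)]
      zero_fanD(10)[OF that(2,3)] that(3) by blast
    then show False using zero_fan_D[OF that] by simp
  qed
  then have "w i = w' i" if "i \<le> k" for i using assms that by (metis linorder_neqE_nat)
  then show ?thesis by (simp add: alternate_def)
qed

text \<open>This is the linear dependence of three plane vectors. Applied around a vertex of weight
  0, it makes the rays of a zero chain change sign after two steps.\<close>

lemma D_opposite:
  assumes "D a b = 1" "D b c = 1" "D a c = 0"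
  shows "X c = - X a" "Y c = - Y a"
proof -
  have "X a * D b c - X b * D a c + X c * D a b = 0" "Y a * D b c - Y b * D a c + Y c * D a b = 0"
    by (simp_all add: D_def algebra_simps)
  then show "X c = - X a" "Y c = - Y a" using assms by simp_all
qed

text \<open>Even positions of \<open>S\<close> repeat the starting ray (1, 0) and odd positions the
  ray of the first vertex, up to sign. The second coordinate of the latter is its determinant with
  (1, 0), hence 1; its first coordinate becomes \<open>x\<close>.\<close>

lemma zero_fan_exists:
  assumes S: "good S" and card: "card (S \<inter> {0<..<N}) = 2 * k + 1"
    and zero: "\<And>v. v \<in> verts (graph S) \<Longrightarrow> weight (graph S) v = 0"
  obtains x z w where "zero_fan k x z w" "S = alternate k z w"
proof -
  let ?L = "sorted_list_of_set S"
  define s where "s j = ?L ! j" for j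
  have fin: "finite S" using S by (rule goodD)
  have "S = insert 0 (insert N (S \<inter> {0<..<N}))" using goodD(1-3)[OF S] by force
  moreover have "card (insert 0 (insert N (S \<inter> {0<..<N}))) = Suc (Suc (2 * k + 1))"
    unfolding card[symmetric] using fin by (simp add: N_def)
  ultimately have cS: "card S = 2 * k + 3" by simp
  have L: "length ?L = card S" "sorted ?L" "set ?L = S" using fin by auto
  have co: "consec S (s j) (s (Suc j))" if "j < 2 * k + 2" for j
    unfolding s_def using that cS by (intro consec_sorted_list[OF fin]) simp
  have cone: "cone (s j) (s (Suc j))" if "j < 2 * k + 2" for j
    using co[OF that] goodD(5)[OF S] by blast
  have S_eq: "S = s ` {..2 * k + 2}"
  proof -
    have "(\<lambda>j. ?L ! j) ` {0..<length ?L} = S"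
      using L(3) by (metis map_nth set_map set_upt)
    then have "S = (\<lambda>j. ?L ! j) ` {..<card S}" by (simp only: L(1) atLeast0LessThan)
    moreover have "{..<card S} = {..2 * k + 2}" using cS by auto
    ultimately show ?thesis by (simp add: s_def)
  qed
  have less: "s i < s j" if "i < j" "j \<le> 2 * k + 2" for i j
    by (rule bounded_strict_mono[of "2 * k + 2" s, OF coneD(1)[OF cone] that])
  have s0: "s 0 = 0"
  proof -
    obtain j where "0 = s j" "j \<le> 2 * k + 2" using goodD(2)[OF S] S_eq by auto
    then show ?thesis using less[of 0 j] by (cases "j = 0") auto
  qed
  have sN: "s (2 * k + 2) = N"
  proof -
    obtain j where j: "N = s j" "j \<le> 2 * k + 2" using goodD(3)[OF S] S_eq by auto
    have "s (2 * k + 2) \<le> N" using goodD(1)[OF S] S_eq by auto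
    then show ?thesis using less[of j "2 * k + 2"] j by (cases "j = 2 * k + 2") auto
  qed
  have D0: "D (s j) (s (Suc (Suc j))) = 0" if j: "Suc j < 2 * k + 2" for j
  proof -
    have c: "consec S (s j) (s (Suc j))" "consec S (s (Suc j)) (s (Suc (Suc j)))"
      using co[of j] co[of "Suc j"] j by auto
    have "0 < s (Suc j)" "s (Suc j) < N" "s (Suc j) \<in> S"
      using less[of 0 "Suc j"] less[of "Suc j" "2 * k + 2"] s0 sN j c by (auto simp: consec_def)
    then have "weight (graph S) (nm (s (Suc j))) = 0" using zero nm_in_verts by blast
    then show ?thesis using weight_graph[OF S c] by simp
  qed
  have opp: "X (s (Suc (Suc j))) = - X (s j)" "Y (s (Suc (Suc j))) = - Y (s j)"
    if "Suc j < 2 * k + 2" for j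
    using D_opposite[OF coneD(2)[OF cone] coneD(2)[OF cone] D0[OF that]] that by auto
  define z where "z i = s (2 * i)" for i
  define w where "w i = s (Suc (2 * i))" for i
  have z_rays: "X (z i) = (-1) ^ i \<and> Y (z i) = 0" if "i \<le> Suc k" for i
    using that
  proof (induction i)
    case 0
    then show ?case by (simp add: z_def s0 X_def Y_def)
  next
    case (Suc i)
    then show ?case using opp[of "2 * i"] by (simp add: z_def)
  qed
  have Y1: "Y (s 1) = 1"
    using coneD(2)[OF cone[of 0]] s0 by (simp add: D_def X_def Y_def)
  have w_rays: "X (w i) = (-1) ^ i * X (s 1) \<and> Y (w i) = (-1) ^ i" if "i \<le> k" for i
    using that
  proof (induction i)
    case 0
    then show ?case using Y1 by (simp add: w_def)
  next
    case (Suc i)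
    then show ?case using opp[of "Suc (2 * i)"] by (simp add: w_def)
  qed
  have "zero_fan k (X (s 1)) z w"
    unfolding zero_fan_def using z_rays w_rays cone s0 sN by (simp add: z_def w_def)
  moreover have "S = alternate k z w"
  proof -
    have "{..2 * k + 2} = (\<lambda>i. 2 * i) ` {..Suc k} \<union> (\<lambda>i. Suc (2 * i)) ` {..k}" (is "_ = ?R")
    proof (intro set_eqI iffI)
      fix j assume j: "j \<in> {..2 * k + 2}"
      show "j \<in> ?R"
      proof (cases "even j")
        case True
        then obtain i where "j = 2 * i" by (rule evenE)
        then show ?thesis using j by auto
      next
        case False
        then obtain i where "j = 2 * i + 1" by (rule oddE)
        then show ?thesis using j by auto
      qed
    qed auto
    moreover have "z = (\<lambda>i. s (2 * i))" "w = (\<lambda>i. s (Suc (2 * i)))"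
      by (simp_all add: z_def w_def fun_eq_iff)
    ultimately show ?thesis by (simp only: S_eq image_Un image_image alternate_def)
  qed
  ultimately show thesis by (rule that)
qed

text \<open>The target ray \<open>w' i\<close> lies strictly between \<open>z i\<close> and
  \<open>w i\<close>. So this cone has rays of \<Gamma> inside, hence also its mediant, which is (x
  + 1, 1) up to sign.\<close>

lemma zero_fan_step:
  assumes x: "zero_fan k x z w" and y: "zero_fan k y z w'" and "x < y"
  obtains e where "zero_fan k (x + 1) z e" "\<And>i. i \<le> k \<Longrightarrow> cone (z i) (e i)" "\<And>i. i \<le> k \<Longrightarrow> cone (e i) (w i)"
proof -
  have "\<exists>e. cone (z i) e \<and> cone e (w i)" if i: "i \<le> k" for i
  proof -
    note X = zero_fanD[OF x] and Y = zero_fanD[OF y]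
    have D: "D (w i) (w' i) = x - y" by (rule zero_fan_D[OF x y i])
    have "w' i < w i"
    proof (rule ccontr)
      assume "\<not> w' i < w i"
      then consider "w i = w' i" | "w i < w' i" by linarith
      then show False
      proof cases
        case 1
        then show False using D \<open>x < y\<close> by simp
      next
        case 2
        then have "0 < D (w i) (w' i)" using coneD(3)[OF X(4)[OF i]] Y(10)[OF i] by blast
        then show False using D \<open>x < y\<close> by simp
      qed
    qed
    then have "Suc (z i) < w i" using Y(9)[OF i] by simp
    then show ?thesis using cone_split[OF X(3)[OF i]] by metis
  qed
  then obtain e where e: "\<And>i. i \<le> k \<Longrightarrow> cone (z i) (e i)" "\<And>i. i \<le> k \<Longrightarrow> cone (e i) (w i)"
    by metis
  have mediant: "X c = X a + X b \<and> Y c = Y a + Y b" if "D a b = 1" "D a c = 1" "D c b = 1" for a b c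
  proof -
    have "X c * D a b = X a * D c b + X b * D a c" "Y c * D a b = Y a * D c b + Y b * D a c"
      by (simp_all add: D_def algebra_simps)
    then show ?thesis using that by simp
  qed
  have rays: "X (e i) = (-1) ^ i * (x + 1) \<and> Y (e i) = (-1) ^ i" if i: "i \<le> k" for i
    using mediant[OF coneD(2)[OF zero_fanD(3)[OF x i]] coneD(2)[OF e(1)[OF i]] coneD(2)[OF e(2)[OF i]]]
      zero_fanD(5-8)[OF x] i by (simp add: algebra_simps)
  \<comment> \<open>Merging the cones on both sides of \<open>w i\<close> prepares the contraction
    of that vertex.\<close>
  have "cone (e i) (z (Suc i))" if i: "i \<le> k" for i
  proof (rule cone_merge[OF e(2)[OF i] zero_fanD(4)[OF x i]])
    show "D (e i) (z (Suc i)) = 1"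
      using sign_sq[of i] rays[OF i] zero_fanD(7,8)[OF x, of "Suc i"] i by (simp add: D_def)
  qed
  then have "zero_fan k (x + 1) z e"
    using x e(1) rays by (simp add: zero_fan_def)
  then show thesis using that e by blast
qed

end

section \<open>Moves and elementary transformations\<close>

lemma consec_sorted_list_iff:
  assumes "finite S"
  shows "consec S a b \<longleftrightarrow>
    (\<exists>j. Suc j < card S \<and> a = sorted_list_of_set S ! j \<and> b = sorted_list_of_set S ! Suc j)"
proof
  let ?L = "sorted_list_of_set S"
  assume c: "consec S a b"
  have L: "length ?L = card S" "sorted ?L" "set ?L = S" using assms by auto
  obtain j l where jl: "j < card S" "a = ?L ! j" "l < card S" "b = ?L ! l"
    using c L unfolding consec_def by (metis in_set_conv_nth)
  have "j < l"
  proof (rule ccontr)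
    assume "\<not> j < l"
    then have "b \<le> a" using sorted_nth_mono[OF L(2), of l j] jl L(1) by simp
    then show False using c by (simp add: consec_def)
  qed
  then have "Suc j < card S" using jl by simp
  moreover from this have "b = ?L ! Suc j"
    using consec_sorted_list[OF assms] c jl(2) consec_unique_right by blast
  ultimately show "\<exists>j. Suc j < card S \<and> a = ?L ! j \<and> b = ?L ! Suc j" using jl by blast
qed (use consec_sorted_list[OF assms] in blast)

context chain
begin

lemma order_on_graph:
  "order_on gs (graph S) = map nm (sorted_list_of_set (S \<inter> {0<..<N}))"
proof -
  let ?xs = "filter (\<lambda>i. i \<in> S) [1..<N]"
  have gs: "gs = map nm [1..<N]"
    by (rule nth_equalityI) (auto simp: N_def nm_def simp del: upt_Suc)
  have "order_on gs (graph S) = filter (\<lambda>v. v \<in> verts (graph S)) (map nm [1..<N])"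
    by (simp only: order_on_def gs[symmetric])
  also have "\<dots> = map nm (filter (\<lambda>i. nm i \<in> verts (graph S)) [1..<N])"
    by (simp only: filter_map comp_def)
  also have "filter (\<lambda>i. nm i \<in> verts (graph S)) [1..<N] = ?xs"
    by (rule filter_cong) (auto simp: nm_in_verts)
  also have "?xs = sorted_list_of_set (set ?xs)"
    by (rule sorted_list_of_set.idem_if_sorted_distinct[symmetric]) (auto simp: sorted_wrt_filter)
  also have "set ?xs = S \<inter> {0<..<N}" by auto
  finally show ?thesis .
qed

lemma linear_chain_graph:
  assumes "S \<inter> {0<..<N} \<noteq> {}"
  shows "linear_chain (graph S) (order_on gs (graph S))
    (map (weight (graph S)) (order_on gs (graph S)))"
proof -
  let ?R = "S \<inter> {0<..<N}"
  let ?L = "sorted_list_of_set ?R"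
  have L: "length ?L = card ?R" "set ?L = ?R" "distinct ?L" by simp_all
  have "consec S i j \<and> 0 < i \<and> j < N \<longleftrightarrow> consec ?R i j" for i j
    by (auto simp: consec_def)
  then have "edges (graph S) = {{nm i, nm j} | i j. consec ?R i j}"
    by (simp add: edges_graph)
  also have "\<dots> = {{nm (?L ! j), nm (?L ! Suc j)} | j. Suc j < card ?R}"
    using consec_sorted_list_iff[of ?R] by auto
  also have "\<dots> = {{map nm ?L ! j, map nm ?L ! Suc j} | j. Suc j < length (map nm ?L)}"
    by (intro Collect_cong ex_cong1 rev_conj_cong) (simp_all add: L(1))
  finally have "edges (graph S) = \<dots>" .
  moreover have "distinct (map nm ?L)"
    using L nm_inj by (simp add: distinct_map inj_on_def)
  ultimately show ?thesis
    using assms L by (simp add: linear_chain_def order_on_graph verts_graph)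
qed

text \<open>Since \<open>z 0\<close> is no vertex, the list starts with \<open>w 0\<close>, and the
  odd position \<open>j\<close> holds \<open>z (Suc (j div 2))\<close>.\<close>

lemma order_on_alternate:
  assumes zf: "zero_fan k x z w"
  shows "order_on gs (graph (alternate k z w)) =
    map (\<lambda>j. nm (if even j then w (j div 2) else z (Suc (j div 2)))) [0..<2 * k + 1]"
proof -
  define f where "f j = (if even j then w (j div 2) else z (Suc (j div 2)))" for j
  have f: "f (2 * i) = w i" "f (2 * i + 1) = z (Suc i)" for i by (auto simp: f_def)
  have less: "f j < f (Suc j)" if "j < 2 * k" for j
  proof (cases "even j")
    case True
    then obtain i where "j = 2 * i" by (rule evenE)
    then show ?thesis using that zero_fanD(10)[OF zf, of i] f[of i] by simp
  next
    case False
    then obtain i where "j = 2 * i + 1" by (rule oddE)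
    then show ?thesis using that zero_fanD(9)[OF zf, of "Suc i"] f(2)[of i] f(1)[of "Suc i"] by simp
  qed
  let ?L = "map f [0..<Suc (2 * k)]"
  have sd: "sorted ?L" "distinct ?L"
    using bounded_strict_mono_list[of "2 * k" f, OF less] by blast+
  have L: "set ?L = f ` {..2 * k}" by (simp only: set_map set_upt atLeast0LessThan lessThan_Suc_atMost)
  have "set ?L = alternate k z w \<inter> {0<..<N}" unfolding L
  proof (intro set_eqI iffI)
    fix r assume "r \<in> f ` {..2 * k}"
    then obtain j where j: "j \<le> 2 * k" "r = f j" by auto
    show "r \<in> alternate k z w \<inter> {0<..<N}"
    proof (cases "even j")
      case True
      then obtain i where "j = 2 * i" by (rule evenE)
      then have "i \<le> k" "r = w i" using j f by auto
      then show ?thesis using zero_fanD(9,10)[OF zf, of i]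
        zero_fan_le[OF zf, of "Suc i" "Suc k"] zero_fanD(2)[OF zf] by (auto simp: alternate_def)
    next
      case False
      then obtain i where "j = 2 * i + 1" by (rule oddE)
      then have "i < k" "r = z (Suc i)" using j f by auto
      then show ?thesis using zero_fan_less[OF zf, of 0 "Suc i"]
        zero_fan_less[OF zf, of "Suc i" "Suc k"] zero_fanD(1,2)[OF zf] by (auto simp: alternate_def)
    qed
  next
    fix r assume r: "r \<in> alternate k z w \<inter> {0<..<N}"
    then consider i where "i \<le> k" "r = w i" | i where "i \<le> Suc k" "r = z i"
      unfolding alternate_def by blast
    then show "r \<in> f ` {..2 * k}"
    proof cases
      case (1 i)
      then have "2 * i \<in> {..2 * k}" "r = f (2 * i)" using f by auto
      then show ?thesis by blast
    next
      case (2 i)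
      have "0 < z i" "z i < N" using r 2 by auto
      then have "i \<noteq> 0" "i \<noteq> Suc k" using zero_fanD(1,2)[OF zf] by (metis less_irrefl)+
      then obtain j where "i = Suc j" "j < k" using 2 by (cases i) auto
      then have "2 * j + 1 \<in> {..2 * k}" "r = f (2 * j + 1)" using f 2 by auto
      then show ?thesis by blast
    qed
  qed
  then have "sorted_list_of_set (alternate k z w \<inter> {0<..<N}) = ?L"
    using sorted_list_of_set.idem_if_sorted_distinct[OF sd] by simp
  then have "order_on gs (graph (alternate k z w)) = map nm ?L" by (simp only: order_on_graph)
  then show ?thesis by (simp only: f_def map_map comp_def Suc_eq_plus1)
qed

end

section \<open>Mixed subdivisions between a zero chain and its left move\<close>

locale move = chain \<Gamma> gs ws for \<Gamma> :: "'v wgraph" and gs ws +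
  fixes k :: nat and x :: int and z w e :: "nat \<Rightarrow> nat"
  assumes w: "zero_fan k x z w" and e: "zero_fan k (x + 1) z e"
    and ze: "\<And>i. i \<le> k \<Longrightarrow> cone (z i) (e i)" and ew: "\<And>i. i \<le> k \<Longrightarrow> cone (e i) (w i)"
begin

text \<open>\<open>P\<close> and \<open>Q\<close> collect the blocks in which the new ray and the
  old ray are present. With both full this is the common blowup of the left move; other choices are
  its partial blowups and the stages of the factorization.\<close>

definition fan :: "nat set \<Rightarrow> nat set \<Rightarrow> nat set" where
  "fan P Q = z ` {..Suc k} \<union> e ` P \<union> w ` Q"

lemma block_order:
  assumes "i \<le> k"
  shows "z i < e i" "e i < w i" "w i < z (Suc i)" "z (Suc i) \<le> N"
  using ze[OF assms] ew[OF assms] zero_fanD(10)[OF w assms] zero_fan_le[OF w, of "Suc i" "Suc k"]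
    zero_fanD(2)[OF w] assms by (auto dest: coneD(1))

lemma fan_block:
  assumes "P \<subseteq> {..k}" "Q \<subseteq> {..k}" "i \<le> k" "r \<in> fan P Q" "z i < r" "r < z (Suc i)"
  shows "r = e i \<and> i \<in> P \<or> r = w i \<and> i \<in> Q"
proof -
  from assms(4) consider j where "r = z j" "j \<le> Suc k" | j where "r = e j" "j \<in> P"
    | j where "r = w j" "j \<in> Q"
    unfolding fan_def by auto
  then show ?thesis
  proof cases
    case (1 j)
    then show ?thesis using assms(3,5,6) zero_fan_le[OF w, of j i] zero_fan_le[OF w, of "Suc i" j]
      by (cases "j \<le> i") auto
  next
    case (2 j)
    then have "j \<le> k" using assms(1) by auto
    then have "i = j" using same_block[OF w assms(3), of j r] block_order[of j] 2 assms(5,6) by simp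
    then show ?thesis using 2 by simp
  next
    case (3 j)
    then have "j \<le> k" using assms(2) by auto
    then have "i = j" using same_block[OF w assms(3), of j r] block_order[of j] 3 assms(5,6) by simp
    then show ?thesis using 3 by simp
  qed
qed

lemma consec_fan:
  assumes PQ: "P \<subseteq> {..k}" "Q \<subseteq> {..k}" and i: "i \<le> k"
  shows "i \<in> P \<Longrightarrow> consec (fan P Q) (z i) (e i)"
    "i \<in> P \<Longrightarrow> i \<in> Q \<Longrightarrow> consec (fan P Q) (e i) (w i)"
    "i \<in> P \<Longrightarrow> i \<notin> Q \<Longrightarrow> consec (fan P Q) (e i) (z (Suc i))"
    "i \<in> Q \<Longrightarrow> consec (fan P Q) (w i) (z (Suc i))"
    "i \<in> Q \<Longrightarrow> i \<notin> P \<Longrightarrow> consec (fan P Q) (z i) (w i)"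
proof -
  note o = block_order[OF i] and b = fan_block[OF PQ i]
  have mem: "z i \<in> fan P Q" "z (Suc i) \<in> fan P Q" "i \<in> P \<Longrightarrow> e i \<in> fan P Q"
    "i \<in> Q \<Longrightarrow> w i \<in> fan P Q"
    using i by (auto simp: fan_def)
  show "i \<in> P \<Longrightarrow> consec (fan P Q) (z i) (e i)"
    unfolding consec_def using o b mem by (metis less_irrefl less_trans)
  show "i \<in> P \<Longrightarrow> i \<in> Q \<Longrightarrow> consec (fan P Q) (e i) (w i)"
    unfolding consec_def using o b mem by (metis less_irrefl less_trans)
  show "i \<in> P \<Longrightarrow> i \<notin> Q \<Longrightarrow> consec (fan P Q) (e i) (z (Suc i))"
    unfolding consec_def using o b mem by (metis less_irrefl less_trans)
  show "i \<in> Q \<Longrightarrow> consec (fan P Q) (w i) (z (Suc i))"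
    unfolding consec_def using o b mem by (metis less_irrefl less_trans)
  show "i \<in> Q \<Longrightarrow> i \<notin> P \<Longrightarrow> consec (fan P Q) (z i) (w i)"
    unfolding consec_def using o b mem by (metis less_irrefl less_trans)
qed

text \<open>The condition keeps a ray in every block. In an empty block two opposite multiples of
  (1, 0) would become neighbours, and these span no cone.\<close>

lemma good_fan:
  assumes "P \<union> Q = {..k}"
  shows "good (fan P Q)"
proof -
  have PQ: "P \<subseteq> {..k}" "Q \<subseteq> {..k}" using assms by auto
  have "fan P Q \<subseteq> {..N}"
  proof
    fix r assume "r \<in> fan P Q"
    then consider j where "r = z j" "j \<le> Suc k" | j where "r = e j" "j \<le> k" | j where "r = w j" "j \<le> k"
      using PQ unfolding fan_def by auto
    then show "r \<in> {..N}"
    proof cases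
      case 1
      then show ?thesis using zero_fan_le[OF w, of j "Suc k"] zero_fanD(2)[OF w] by auto
    next
      case (2 j)
      then show ?thesis using block_order[of j] by auto
    next
      case (3 j)
      then show ?thesis using block_order[of j] by auto
    qed
  qed
  moreover have "0 \<in> fan P Q" "N \<in> fan P Q"
    unfolding fan_def using zero_fanD(1,2)[OF w] by (metis UnCI atMost_iff imageI le0 le_refl)+
  moreover have "cone a b" if c: "consec (fan P Q) a b" for a b
  proof -
    have ab: "a \<in> fan P Q" "b \<in> fan P Q" "a < b" using c by (auto simp: consec_def)
    then have "a < N" using \<open>fan P Q \<subseteq> {..N}\<close> by force
    then obtain i where i: "i \<le> k" "z i \<le> a" "a < z (Suc i)" using zero_fan_block[OF w] by blast
    note cs = consec_fan[OF PQ i(1)] and cones = ze[OF i(1)] ew[OF i(1)]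
      zero_fanD(3,4)[OF w i(1)] zero_fanD(4)[OF e i(1)]
    \<comment> \<open>The successor of \<open>a\<close> is unique, so \<open>b\<close> is the one
      listed in \<open>consec_fan\<close>, and each listed pair is known to be a cone.\<close>
    have "i \<in> P \<or> i \<in> Q" using assms i(1) by auto
    moreover have "a = z i \<or> a = e i \<and> i \<in> P \<or> a = w i \<and> i \<in> Q"
      using fan_block[OF PQ i(1) ab(1)] i by linarith
    ultimately show ?thesis using cs cones consec_unique_right[OF c] by metis
  qed
  ultimately show ?thesis by (simp add: good_def)
qed

lemma fan_real: "P \<union> Q = {..k} \<Longrightarrow> fan P Q \<inter> {0<..<N} \<noteq> {}"
proof -
  assume "P \<union> Q = {..k}"
  then have "0 \<in> P \<or> 0 \<in> Q" by auto
  then have "e 0 \<in> fan P Q \<or> w 0 \<in> fan P Q" by (auto simp: fan_def)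
  moreover have "0 < e 0" "e 0 < w 0" "w 0 < N" using block_order[of 0] by auto
  ultimately show ?thesis by fastforce
qed

lemma fan_insert: "fan (insert i P) Q = insert (e i) (fan P Q)" "fan P (insert i Q) = insert (w i) (fan P Q)"
  by (auto simp: fan_def)

lemma alternate_fan: "alternate k z w = fan {} {..k}" "alternate k z e = fan {..k} {}"
  by (auto simp: alternate_def fan_def)

lemma fan_dominated: "P \<union> Q = {..k} \<Longrightarrow> blowup\<^sup>*\<^sup>* (graph (fan P Q)) \<Gamma>"
  by (intro good_dominated good_fan fan_real)

end

section \<open>Graphs of zero chains and the sliding of a ray\<close>

context chain
begin

lemma alternate_block:
  assumes zf: "zero_fan k x z w" and i: "i \<le> k" and r: "r \<in> alternate k z w" "z i \<le> r" "r < z (Suc i)"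
  shows "r = z i \<or> r = w i"
proof (rule ccontr)
  assume "\<not> ?thesis"
  then have r': "z i < r" "r \<noteq> w i" using r by auto
  consider j where "j \<le> Suc k" "r = z j" | j where "j \<le> k" "r = w j"
    using r unfolding alternate_def by blast
  then show False
  proof cases
    case (1 j)
    then show ?thesis using r' r(3) i zero_fan_le[OF zf, of j i] zero_fan_le[OF zf, of "Suc i" j]
      by (cases "j \<le> i") auto
  next
    case (2 j)
    then show ?thesis using r' r(3) same_block[OF zf i, of j r] zero_fanD(9,10)[OF zf, of j] by auto
  qed
qed

lemma consec_alternate:
  assumes zf: "zero_fan k x z w" and c: "consec (alternate k z w) a b"
  shows "\<exists>i\<le>k. a = z i \<and> b = w i \<or> a = w i \<and> b = z (Suc i)"
proof -
  have ab: "a \<in> alternate k z w" "b \<in> alternate k z w" "a < b"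
    and between: "\<And>r. r \<in> alternate k z w \<Longrightarrow> \<not> (a < r \<and> r < b)"
    using c by (auto simp: consec_def)
  have "a < N"
  proof (rule ccontr)
    assume "\<not> a < N"
    then have "N < b" using ab by simp
    moreover have "b \<le> N" using ab(2) unfolding alternate_def
      using zero_fan_le[OF zf, of _ "Suc k"] zero_fanD(2,10)[OF zf] by fastforce
    ultimately show False by simp
  qed
  then obtain i where i: "i \<le> k" "z i \<le> a" "a < z (Suc i)" using zero_fan_block[OF zf] by blast
  have mem: "w i \<in> alternate k z w" "z (Suc i) \<in> alternate k z w" using i by (auto simp: alternate_def)
  note o = zero_fanD(9,10)[OF zf i(1)]
  have b: "b \<le> z (Suc i)" using between[OF mem(2)] i by simp
  have "b = w i \<or> b = z (Suc i)"
  proof (cases "b = z (Suc i)")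
    case False
    then show ?thesis using alternate_block[OF zf i(1) ab(2)] b i(2) ab(3) by auto
  qed simp
  moreover have "a = z i \<or> a = w i" using alternate_block[OF zf i(1) ab(1) i(2,3)] .
  ultimately show ?thesis using between[OF mem(1)] o ab(3) i(1) by auto
qed

lemma good_alternate:
  assumes zf: "zero_fan k x z w"
  shows "good (alternate k z w)"
proof -
  have "alternate k z w \<subseteq> {..N}" unfolding alternate_def
    using zero_fan_le[OF zf, of _ "Suc k"] zero_fanD(2,10)[OF zf] by fastforce
  moreover have "0 \<in> alternate k z w" "N \<in> alternate k z w"
    unfolding alternate_def using zero_fanD(1,2)[OF zf] by (metis UnCI atMost_iff imageI le0 le_refl)+
  moreover have "cone a b" if "consec (alternate k z w) a b" for a b
    using consec_alternate[OF zf that] zero_fanD(3,4)[OF zf] by metis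
  ultimately show ?thesis by (simp add: good_def)
qed

lemma alternate_real:
  assumes zf: "zero_fan k x z w"
  shows "alternate k z w \<inter> {0<..<N} \<noteq> {}"
proof -
  have "w 0 \<in> alternate k z w" by (simp add: alternate_def)
  moreover have "0 < w 0" "w 0 < N"
    using zero_fanD(1,2)[OF zf] zero_fanD(9,10)[OF zf, of 0] zero_fan_le[OF zf, of 1 "Suc k"] by auto
  ultimately show ?thesis by auto
qed

text \<open>The two neighbours of a vertex are both multiples of (1, 0) or both multiples of (x, 1),
  so their determinant vanishes.\<close>

lemma linear_chain_alternate:
  assumes zf: "zero_fan k x z w"
  shows "linear_chain (graph (alternate k z w)) (order_on gs (graph (alternate k z w)))
    (replicate (2 * k + 1) 0)"
proof -
  let ?S = "alternate k z w"
  note S = good_alternate[OF zf]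
  have "weight (graph ?S) v = 0" if v: "v \<in> verts (graph ?S)" for v
  proof -
    obtain r where r: "v = nm r" "r \<in> ?S" "0 < r" "r < N" using v by (auto simp: verts_graph)
    obtain p q where pq: "consec ?S p r" "consec ?S r q" using good_neighbours[OF S r(2-4)] by blast
    obtain i where i: "i \<le> k" "p = z i \<and> r = w i \<or> p = w i \<and> r = z (Suc i)"
      using consec_alternate[OF zf pq(1)] by blast
    obtain j where j: "j \<le> k" "r = z j \<and> q = w j \<or> r = w j \<and> q = z (Suc j)"
      using consec_alternate[OF zf pq(2)] by blast
    have Yw: "Y (w i) \<noteq> 0" "Y (w j) \<noteq> 0" using zero_fanD(6)[OF zf] i j by auto
    have Yz: "Y (z i) = 0" "Y (z j) = 0" "Y (z (Suc i)) = 0" "Y (z (Suc j)) = 0"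
      using zero_fanD(8)[OF zf] i j by auto
    have "p = z i \<and> q = z (Suc j) \<or> p = w i \<and> q = w j" using i(2) j(2) Yw Yz by metis
    then have "D p q = 0"
      using Yz zero_fanD(5,6)[OF zf i(1)] zero_fanD(5,6)[OF zf j(1)] by (auto simp: D_def)
    then show ?thesis using weight_graph[OF S pq] r by simp
  qed
  moreover have "set (order_on gs (graph ?S)) = verts (graph ?S)"
    using linear_chain_graph[OF alternate_real[OF zf]] by (simp add: linear_chain_def)
  ultimately have "map (weight (graph ?S)) (order_on gs (graph ?S)) = replicate (2 * k + 1) 0"
    by (intro replicate_eqI) (auto simp: order_on_alternate[OF zf])
  then show ?thesis using linear_chain_graph[OF alternate_real[OF zf]] by simp
qed

lemma degree_graph:
  assumes S: "good S" and c: "consec S p v" "consec S v q" and "0 < p \<or> q < N"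
  shows "degree (graph S) (nm v) \<in> {1, 2}"
proof -
  let ?E = "{d \<in> edges (graph S). nm v \<in> d}"
  have r: "0 < v" "v < N" "p < v" "v < q"
    using c goodD(1)[OF S] by (auto simp: consec_def)
  have "?E \<subseteq> {{nm p, nm v}, {nm v, nm q}}"
  proof
    fix d assume "d \<in> ?E"
    then obtain a b where ab: "d = {nm a, nm b}" "consec S a b" "0 < a" "b < N" "nm v = nm a \<or> nm v = nm b"
      by (auto simp: edges_graph)
    then have "v = a \<or> v = b" using r nm_eq[of v a] nm_eq[of v b] by (auto simp: consec_def)
    then show "d \<in> {{nm p, nm v}, {nm v, nm q}}"
      using ab c consec_unique_left consec_unique_right by blast
  qed
  moreover have "{nm p, nm v} \<in> ?E \<or> {nm v, nm q} \<in> ?E"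
    using assms(4) c r(1,2) unfolding edges_graph by blast
  moreover have "card {{nm p, nm v}, {nm v, nm q}} \<le> 2" by (simp add: card_insert_if)
  moreover have fin: "finite {{nm p, nm v}, {nm v, nm q}}" by simp
  ultimately have "card ?E \<le> 2" "?E \<noteq> {}" "finite ?E"
    using card_mono[OF fin, of ?E] finite_subset[of ?E] by (auto simp del: insert_iff)
  then have "0 < card ?E" "card ?E \<le> 2" by (auto simp: card_gt_0_iff)
  then show ?thesis unfolding degree_def by auto
qed

lemma verts_graph_remove:
  assumes "0 < v" "v < N"
  shows "verts (graph (S - {v})) = verts (graph S) - {nm v}"
proof -
  have "(S - {v}) \<inter> {0<..<N} = (S \<inter> {0<..<N}) - {v}" by auto
  moreover have "nm ` ((S \<inter> {0<..<N}) - {v}) = nm ` (S \<inter> {0<..<N}) - nm ` {v}"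
    using nm_inj assms by (intro inj_on_image_set_diff[of _ "{0<..<N}"]) auto
  ultimately show ?thesis by (simp add: verts_graph)
qed

text \<open>If \<open>p\<close> is not a vertex, there is no edge to blow up on the side of \<open>e\<close>, and the
  transformation is the inverse of the one sliding \<open>e\<close> past \<open>v\<close>.\<close>

lemma elementary_slide:
  assumes S: "good S" and c: "consec S p v" "consec S v q" and D: "D p q = 0"
    and e: "cone p e" "cone e v"
  defines "T \<equiv> insert e S"
  shows "elementary (graph S) (graph T) (graph (T - {v}))" "good (T - {v})"
proof -
  have r: "p < e" "e < v" "v < q" "q \<le> N" using c e goodD(1)[OF S] by (auto simp: consec_def dest: coneD)
  note gT = good_insert[OF S c(1) e]
  have eS: "e \<notin> S" "v \<in> S" using c(1) r by (auto simp: consec_def)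
  note ci = consec_insert[OF c(1) r(1,2)]
  have cT: "consec T e v" "consec T v q" "consec T p e" using c(2) r by (auto simp: T_def ci)
  have Dpv: "D p v = 1" using goodD(5)[OF S c(1)] by (rule coneD)
  have "D e q = D p q + D v q" by (rule D_mediant[OF Dpv coneD(2)[OF e(1)] coneD(2)[OF e(2)]])
  \<comment> \<open>Thus \<open>v\<close> has weight -1 in \<open>graph T\<close> and may be
    contracted.\<close>
  then have Deq: "D e q = 1" using D coneD(2)[OF goodD(5)[OF S c(2)]] by simp
  note rm = remove[OF gT[folded T_def] cT(1,2) Deq]
  show good': "good (T - {v})" by (rule rm(1))
  have c': "consec (T - {v}) p e"
    using cT(3) r unfolding consec_def by auto
  have real: "S \<inter> {0<..<N} \<noteq> {}" "(T - {v}) \<inter> {0<..<N} \<noteq> {}"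
    using eS r by (auto simp: T_def)
  have up: "blowup (graph S) (graph T)" "blowup (graph (T - {v})) (graph T)"
    using blowup_insert[OF S c(1) e real(1)] blowup_insert[OF rm(1-4) real(2)] rm(5)
    by (auto simp: T_def)
  have weights: "weight (graph S) (nm v) = 0" "weight (graph (T - {v})) (nm e) = 0"
    using weight_graph[OF S c] weight_graph[OF good' c' rm(2)] D by simp_all
  have vS: "nm v \<in> verts (graph S)" "nm e \<notin> verts (graph S)"
    "nm e \<in> verts (graph (T - {v}))" "nm v \<notin> verts (graph (T - {v}))"
    using r eS by (auto simp: nm_in_verts T_def)
  have wg: "weighted_graph (graph S)" "weighted_graph (graph (T - {v}))"
    using weighted_graph_graph S good' real by blast+
  have vT: "verts (graph (T - {v})) = verts (graph T) - {nm v}"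
    "verts (graph S) = verts (graph T) - {nm e}"
    using verts_graph_remove[of v T] verts_graph_remove[of e T] r eS by (auto simp: T_def)
  consider "0 < p" | "p = 0" "q < N" | "p = 0" "q = N" using r by linarith
  then show "elementary (graph S) (graph T) (graph (T - {v}))"
  proof cases
    case 1
    have "graph T = inner_blowup (nm p) (nm v) (nm e) (graph S)"
      unfolding T_def using 1 r by (intro graph_insert_inner[OF S c(1) e]) auto
    moreover have "nm p \<noteq> nm v" using 1 r by (simp add: nm_eq)
    ultimately have "graph T = inner_blowup (nm v) (nm p) (nm e) (graph S)"
      by (simp add: inner_blowup_commute)
    moreover have "{nm v, nm p} \<in> edges (graph S)"
      using 1 r c(1) edge_graph_iff[OF goodD(1)[OF S], of v p] by simp
    moreover have "degree (graph S) (nm v) \<in> {1, 2}"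
      using degree_graph[OF S c] 1 by simp
    ultimately show ?thesis
      using elementary.edge[OF wg(1) vS(1) weights(1) _ _ vS(2) _ up(2) vT(1)] by blast
  next
    case 2
    have "graph (insert v (T - {v})) = inner_blowup (nm e) (nm q) (nm v) (graph (T - {v}))"
      using 2 r by (intro graph_insert_inner[OF rm(1-4)]) auto
    then have "graph T = inner_blowup (nm e) (nm q) (nm v) (graph (T - {v}))"
      using rm(5) by simp
    moreover have "{nm e, nm q} \<in> edges (graph (T - {v}))"
      using 2 r rm(2) edge_graph_iff[OF goodD(1)[OF good'], of e q] by simp
    moreover have "degree (graph (T - {v})) (nm e) \<in> {1, 2}"
      using degree_graph[OF good' c' rm(2)] 2 by simp
    ultimately have "elementary (graph (T - {v})) (graph T) (graph S)"
      using elementary.edge[OF wg(2) vS(3) weights(2) _ _ vS(4) _ up(1) vT(2)] by blast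
    then show ?thesis by (rule elementary.inverse)
  next
    \<comment> \<open>Without a vertex on either side of \<open>v\<close> the chain is [[0]], where
      only the outer blowup of the one-vertex case is available.\<close>
    case 3
    have only: "r = 0 \<or> r = v \<or> r = N" if "r \<in> S" for r
      using that c 3 goodD(1)[OF S] unfolding consec_def by (metis atMost_iff bot_nat_0.not_eq_extremum linorder_neqE_nat nat_less_le subsetD)
    have "S \<inter> {0<..<N} \<subseteq> {v}" by (auto dest!: only)
    then have "S \<inter> {0<..<N} = {v}" using r eS by auto
    moreover have "edges (graph S) = {}"
    proof -
      have "\<not> (consec S i j \<and> 0 < i \<and> j < N)" for i j
        using only[of i] only[of j] by (auto simp: consec_def)
      then show ?thesis by (auto simp: edges_graph)
    qed
    ultimately have "linear_chain (graph S) [nm v] [0]"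
      using weights(1) by (simp add: linear_chain_def verts_graph)
    moreover have "graph T = outer_blowup (nm v) (nm e) (graph S)"
      unfolding T_def using 3 c(1) e r by (intro graph_insert_left[OF S]) auto
    ultimately show ?thesis using elementary.single[OF _ vS(2) _ up(2) vT(1)] by blast
  qed
qed

text \<open>The dominations of both end graphs are included to make the relation symmetric under
  reversal, so that right moves and inverse compositions come from
  \<open>step_converse\<close>.\<close>

definition step ::
    "('v wgraph \<Rightarrow> 'v wgraph \<Rightarrow> 'v wgraph \<Rightarrow> bool) \<Rightarrow> 'v wgraph \<Rightarrow> 'v wgraph \<Rightarrow> bool" where
  "step R G G' \<longleftrightarrow> (\<exists>Y. R G Y G' \<and> blowup\<^sup>*\<^sup>* Y \<Gamma> \<and> blowup\<^sup>*\<^sup>* G \<Gamma> \<and> blowup\<^sup>*\<^sup>* G' \<Gamma>)"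

lemma step_converse:
  assumes "\<And>G Y G'. R G Y G' \<Longrightarrow> R' G' Y G" "(step R ^^ n) G H"
  shows "(step R' ^^ n) H G"
  using assms(2)
proof (induction n arbitrary: H)
  case (Suc n)
  then obtain K where "(step R ^^ n) G K" "step R K H" by (auto elim: relpowp_Suc_E)
  then have "(step R' ^^ n) K G" "step R' H K"
    using Suc.IH assms(1) unfolding step_def by blast+
  then show ?case by (blast intro: relpowp_Suc_I2)
qed simp

text \<open>The given chain already dominates all the graphs that occur, so no further blowups of it are
  needed.\<close>

lemma composition_ofI:
  assumes "(step (R gs) ^^ n) G H" "blowup\<^sup>*\<^sup>* G \<Gamma>" "wgraph_iso f A G" "wgraph_iso g B H"
  shows "composition_of R n \<Gamma> gs f A g B"
proof -
  obtain F where F: "F 0 = G" "F n = H" "\<And>i. i < n \<Longrightarrow> step (R gs) (F i) (F (Suc i))"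
    using assms(1) unfolding relpowp_fun_conv by blast
  then obtain Y where Y: "\<And>i. i < n \<Longrightarrow> R gs (F i) (Y i) (F (Suc i)) \<and> blowup\<^sup>*\<^sup>* (Y i) \<Gamma>"
    unfolding step_def by metis
  have "blowup\<^sup>*\<^sup>* (F i) \<Gamma>" if "i \<le> n" for i
    using F(1) F(3)[of "i - 1"] assms(2) that by (cases i) (auto simp: step_def)
  moreover have "order_on gs \<Gamma> = gs"
    using chain by (auto simp: order_on_def linear_chain_def)
  ultimately show ?thesis
    unfolding composition_of_def using chain F Y assms(3,4) by blast
qed

end

section \<open>The left move and its factorization\<close>

context move
begin

lemma notin_fan:
  assumes "P \<subseteq> {..k}" "Q \<subseteq> {..k}" "i \<le> k"
  shows "i \<notin> P \<Longrightarrow> e i \<notin> fan P Q" "i \<notin> Q \<Longrightarrow> w i \<notin> fan P Q"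
  using fan_block[OF assms] block_order[OF assms(3)] by force+

text \<open>The blocks are treated one at a time: after \<open>m\<close> slides the first
  \<open>m\<close> blocks carry the new ray and the others still the old one.\<close>

lemma elementary_move: "(step elementary)\<^sup>*\<^sup>* (graph (alternate k z w)) (graph (alternate k z e))"
proof -
  have "(step elementary)\<^sup>*\<^sup>* (graph (fan {} {..k})) (graph (fan {..<m} {m..k}))" if "m \<le> Suc k" for m
    using that
  proof (induction m)
    case 0
    then show ?case by (simp add: atLeast0AtMost)
  next
    case (Suc m)
    let ?S = "fan {..<m} {m..k}" and ?S' = "fan {..<Suc m} {Suc m..k}"
    have PQ: "{..<m} \<union> {m..k} = {..k}" "{..<Suc m} \<union> {Suc m..k} = {..k}"
      "{..<Suc m} \<union> {m..k} = {..k}" and m: "m \<le> k" using Suc by auto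
    have "{m..k} = insert m {Suc m..k}" using m by auto
    then have T: "insert (e m) ?S = fan {..<Suc m} {m..k}" "insert (e m) ?S = insert (w m) ?S'"
      by (auto simp: lessThan_Suc fan_insert)
    have sub: "{..<m} \<subseteq> {..k}" "{m..k} \<subseteq> {..k}" "{..<Suc m} \<subseteq> {..k}" "{Suc m..k} \<subseteq> {..k}"
      using m by auto
    have c: "consec ?S (z m) (w m)" "consec ?S (w m) (z (Suc m))"
      using m by (auto intro!: consec_fan[OF sub(1,2)])
    have "w m \<notin> ?S'" using notin_fan(2)[OF sub(3,4) m] by simp
    then have S': "insert (e m) ?S - {w m} = ?S'" unfolding T(2) by simp
    have "D (z m) (z (Suc m)) = 0" using zero_fanD(8)[OF w] m by (simp add: D_def)
    then have "elementary (graph ?S) (graph (insert (e m) ?S)) (graph ?S')"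
      using elementary_slide(1)[OF good_fan[OF PQ(1)] c _ ze[OF m] ew[OF m]] S' by simp
    then have "step elementary (graph ?S) (graph ?S')"
      unfolding step_def T(1) using fan_dominated PQ by blast
    then show ?case using Suc by (meson Suc_leD rtranclp.rtrancl_into_rtrancl)
  qed
  from this[of "Suc k"] show ?thesis by (simp add: alternate_fan lessThan_Suc_atMost)
qed

text \<open>Every blowup takes place in the cone from \<open>z i\<close> to \<open>w i\<close>. For
  \<open>0 < i\<close> this is the edge from \<open>a ! (2 * i - 1)\<close> to
  \<open>a ! (2 * i)\<close>; for \<open>i = 0\<close> the left generator is no vertex, which gives
  the outer blowup.\<close>

lemma left_move_fan:
  "left_move gs (graph (alternate k z w)) (graph (fan {..k} {..k})) (graph (alternate k z e))"
proof -
  let ?S = "alternate k z w" and ?T = "fan {..k} {..k}" and ?S' = "alternate k z e"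
  define a where "a = order_on gs (graph ?S)"
  define es where "es = map (\<lambda>i. nm (e i)) [0..<k + 1]"
  have a: "a = map (\<lambda>j. nm (if even j then w (j div 2) else z (Suc (j div 2)))) [0..<2 * k + 1]"
    unfolding a_def by (rule order_on_alternate[OF w])
  have a_even: "a ! (2 * i) = nm (w i)" if "i \<le> k" for i
    using that unfolding a by (subst nth_map) (auto simp del: upt_Suc)
  have a_odd: "a ! (2 * i - 1) = nm (z i)" if i: "0 < i" "i \<le> k" for i
  proof -
    obtain j where "i = Suc j" using i by (cases i) auto
    then show ?thesis using i unfolding a by (subst nth_map) (auto simp del: upt_Suc)
  qed
  have es: "es ! i = nm (e i)" if "i \<le> k" for i
    using that unfolding es_def by (subst nth_map) (auto simp del: upt_Suc)
  have pos: "0 < e i" "e i < N" "0 < w i" "w i < N" if "i \<le> k" for i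
    using block_order[OF that] by auto
  have e_less: "e i < e j" if "i < j" "j \<le> k" for i j
    using block_order[of i] block_order[of j] zero_fan_le[OF w, of "Suc i" j] that by simp
  have blowups: "fold (\<lambda>i. inner_blowup (a ! (2 * i - 1)) (a ! (2 * i)) (es ! i)) [1..<Suc m]
      (outer_blowup (a ! 0) (es ! 0) (graph ?S)) = graph (fan {..m} {..k})" if "m \<le> k" for m
    using that
  proof (induction m)
    case 0
    have "consec ?S 0 (w 0)"
      using consec_fan(5)[of "{}" "{..k}" 0] zero_fanD(1)[OF w] by (simp add: alternate_fan)
    then have "graph (insert (e 0) ?S) = outer_blowup (nm (w 0)) (nm (e 0)) (graph ?S)"
      using ze[of 0] ew[of 0] zero_fanD(1)[OF w] pos(4)[of 0]
      by (intro graph_insert_left[OF good_alternate[OF w]]) auto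
    moreover have "insert (e 0) ?S = fan {..0} {..k}" by (auto simp: alternate_fan fan_def)
    ultimately show ?case using a_even[of 0] es[of 0] by simp
  next
    case (Suc m)
    have sub: "{..m} \<subseteq> {..k}" "{..m} \<union> {..k} = {..k}" using Suc by auto
    have zm: "0 < z (Suc m)" using zero_fan_less[OF w, of 0 "Suc m"] zero_fanD(1)[OF w] Suc by simp
    have "graph (insert (e (Suc m)) (fan {..m} {..k})) =
        inner_blowup (nm (z (Suc m))) (nm (w (Suc m))) (nm (e (Suc m))) (graph (fan {..m} {..k}))"
      using Suc ze[of "Suc m"] ew[of "Suc m"] zm pos(4)[of "Suc m"] sub
      by (intro graph_insert_inner good_fan consec_fan(5)) auto
    then show ?case
      using Suc a_even[of "Suc m"] a_odd[of "Suc m"] es[of "Suc m"]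
      by (simp add: atMost_Suc fan_insert)
  qed
  \<comment> \<open>The contractions are read upwards: \<open>w m\<close> is put back between
    \<open>e m\<close> and \<open>z (Suc m)\<close>.\<close>
  have downs: "blowup\<^sup>*\<^sup>* (graph ?S') (graph (fan {..k} {..<m}))" if "m \<le> Suc k" for m
    using that
  proof (induction m)
    case 0
    then show ?case by (simp add: alternate_fan)
  next
    case (Suc m)
    have sub: "{..<m} \<subseteq> {..k}" "{..k} \<union> {..<m} = {..k}" "m \<le> k" using Suc by auto
    have "blowup (graph (fan {..k} {..<m})) (graph (insert (w m) (fan {..k} {..<m})))"
      using ew[OF sub(3)] zero_fanD(4)[OF w sub(3)] sub
      by (intro blowup_insert[of _ "e m" "z (Suc m)"] good_fan consec_fan(3) fan_real) auto
    then show ?case using Suc by (simp add: lessThan_Suc fan_insert)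
  qed
  have T: "good ?T" "?T \<inter> {0<..<N} \<noteq> {}" by (intro good_fan fan_real; simp)+
  have e0: "consec ?T 0 (e 0)" using consec_fan(1)[of "{..k}" "{..k}" 0] zero_fanD(1)[OF w] by simp
  have "Min (?T \<inter> {0<..<N}) = e 0"
    using e0 pos(1,2)[of 0] by (intro Min_eqI) (auto simp: consec_def not_less)
  then have hd: "hd (order_on gs (graph ?T)) = es ! 0"
    using T(2) es[of 0] by (simp add: order_on_graph sorted_list_of_set_nonempty)
  have verts: "verts (graph ?S') = verts (graph ?T) - {a ! (2 * i) | i. i \<le> k}"
  proof -
    have "?S' = ?T - w ` {..k}"
      using notin_fan(2)[of "{..k}" "{}"] by (auto simp: alternate_fan fan_def)
    then have "?S' \<inter> {0<..<N} = (?T \<inter> {0<..<N}) - w ` {..k}" by auto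
    moreover have "nm ` ((?T \<inter> {0<..<N}) - w ` {..k}) = nm ` (?T \<inter> {0<..<N}) - nm ` w ` {..k}"
      using nm_inj pos(3,4) by (intro inj_on_image_set_diff[of _ "{0<..<N}"]) auto
    moreover have "nm ` w ` {..k} = {a ! (2 * i) | i. i \<le> k}" using a_even by force
    ultimately show ?thesis by (simp add: verts_graph)
  qed
  have "nm (e i) \<noteq> nm (e j)" if "i < j" "j \<le> k" for i j
    using e_less[OF that] pos(1,2)[of i] pos(1,2)[of j] that by (simp add: nm_eq)
  then have "inj_on (\<lambda>i. nm (e i)) {..k}"
    unfolding inj_on_def by (metis atMost_iff linorder_neqE_nat)
  then have "distinct es"
    by (simp add: es_def distinct_map atLeast0LessThan lessThan_Suc_atMost del: upt_Suc)
  moreover have "set es \<inter> verts (graph ?S) = {}"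
    using notin_fan(1)[of "{}" "{..k}"] pos(1,2)
    by (auto simp: es_def alternate_fan nm_in_verts simp del: upt_Suc)
  moreover have "length es = k + 1" by (simp add: es_def)
  moreover have "blowup\<^sup>*\<^sup>* (graph ?S') (graph ?T)"
    using downs[of "Suc k"] by (simp add: lessThan_Suc_atMost)
  moreover have "graph ?T = fold (\<lambda>i. inner_blowup (a ! (2 * i - 1)) (a ! (2 * i)) (es ! i)) [1..<k + 1]
      (outer_blowup (a ! 0) (es ! 0) (graph ?S))"
    using blowups[of k] by (simp del: upt_Suc)
  ultimately show ?thesis
    unfolding left_move_def
    using a_def linear_chain_alternate[OF w] linear_chain_alternate[OF e] linear_chain_graph[OF T(2)]
      hd verts by blast
qed

lemma step_left_move: "step (left_move gs) (graph (alternate k z w)) (graph (alternate k z e))"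
  unfolding step_def using left_move_fan fan_dominated by (auto simp: alternate_fan)

end

section \<open>Powers of the left move\<close>

context chain
begin

text \<open>The target stays fixed in the induction, since its rays guarantee that \<Gamma> contains
  the mediants for the next step.\<close>

lemma move_power:
  assumes "zero_fan k x z w" "zero_fan k (x + int n) z w'"
  shows "(step (left_move gs) ^^ n) (graph (alternate k z w)) (graph (alternate k z w')) \<and>
    (step elementary)\<^sup>*\<^sup>* (graph (alternate k z w)) (graph (alternate k z w'))"
  using assms
proof (induction n arbitrary: x w)
  case 0
  then have "alternate k z w = alternate k z w'" using zero_fan_same[of k x z w w'] by simp
  then show ?case by simp
next
  case (Suc n)
  obtain e where e: "zero_fan k (x + 1) z e" "\<And>i. i \<le> k \<Longrightarrow> cone (z i) (e i)"
    "\<And>i. i \<le> k \<Longrightarrow> cone (e i) (w i)"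
    using zero_fan_step[OF Suc.prems] by auto
  interpret move \<Gamma> gs ws k x z w e
    by unfold_locales (use Suc.prems(1) e in auto)
  have "zero_fan k (x + 1 + int n) z w'" using Suc.prems(2) by (simp add: add.assoc)
  note IH = Suc.IH[OF e(1) this]
  show ?case
    using relpowp_Suc_I2[OF step_left_move conjunct1[OF IH]]
      rtranclp_trans[OF elementary_move conjunct2[OF IH]] by blast
qed

text \<open>The isomorphism transports the number of vertices and the zero weights, which is what
  \<open>zero_fan_exists\<close> needs besides a good set.\<close>

lemma domination_zero_fan:
  assumes "\<exists>a. linear_chain A a (replicate (2 * k + 1) 0)" "domination \<Gamma> f A"
  obtains x z w where "zero_fan k x z w" "wgraph_iso f A (graph (alternate k z w))"
proof -
  obtain a where a: "linear_chain A a (replicate (2 * k + 1) 0)" using assms(1) by blast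
  obtain A' where A': "wgraph_iso f A A'" "blowup\<^sup>*\<^sup>* A' \<Gamma>"
    using assms(2) by (auto simp: domination_def)
  obtain S where S: "good S" "same_graph A' (graph S)" using dominated_good[OF A'(2)] by blast
  have iso: "wgraph_iso f A (graph S)" using wgraph_iso_same[OF A'(1) S(2)] .
  have A: "verts A = set a" "distinct a" "map (weight A) a = replicate (2 * k + 1) 0"
    using a by (simp_all only: linear_chain_def)
  then have "length a = 2 * k + 1" by (metis length_map length_replicate)
  then have "card (verts A) = 2 * k + 1" using A by (simp add: distinct_card)
  then have "card (verts (graph S)) = 2 * k + 1" using iso by (simp add: wgraph_iso_def card_image)
  moreover have "card (verts (graph S)) = card (S \<inter> {0<..<N})"
    unfolding verts_graph using nm_inj by (intro card_image) (auto intro: inj_on_subset)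
  ultimately have "card (S \<inter> {0<..<N}) = 2 * k + 1" by simp
  moreover have "weight (graph S) v = 0" if v: "v \<in> verts (graph S)" for v
  proof -
    obtain u where u: "u \<in> verts A" "v = f u" using v iso by (auto simp: wgraph_iso_def)
    then have "weight A u \<in> set (map (weight A) a)" using A(1) by simp
    then have "weight A u = 0" unfolding A(3) set_replicate_conv_if by simp
    then show ?thesis using u iso by (simp add: wgraph_iso_def)
  qed
  ultimately obtain x z w where "zero_fan k x z w" "S = alternate k z w"
    using zero_fan_exists[OF S(1)] by blast
  then show thesis using that iso by blast
qed

end

theorem proposition3p7:
  fixes k l :: nat
    and A :: "'a wgraph" and B :: "'b wgraph" and \<Gamma> :: "'v wgraph"
    and f :: "'a \<Rightarrow> 'v" and g :: "'b \<Rightarrow> 'v"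
    and gs :: "'v list" and ws :: "int list"
  assumes "\<exists>a. linear_chain A a (replicate (2 * k + 1) 0)"
    and "\<exists>b. linear_chain B b (replicate (2 * l + 1) 0)"
    and "linear_chain \<Gamma> gs ws"
    and "domination \<Gamma> f A"
    and "domination \<Gamma> g B"
  shows "k = l \<and> (\<exists>s::int. equals_move_power s \<Gamma> gs f A g B) \<and>
         composition_of_elementary \<Gamma> gs f A g B"
proof -
  interpret chain \<Gamma> gs ws by unfold_locales (rule assms(3))
  obtain x z w where A: "zero_fan k x z w" "wgraph_iso f A (graph (alternate k z w))"
    using domination_zero_fan[OF assms(1,4)] by blast
  obtain y z' w' where B: "zero_fan l y z' w'" "wgraph_iso g B (graph (alternate l z' w'))"
    using domination_zero_fan[OF assms(2,5)] by blast
  note uniq = zero_fan_unique[OF A(1) B(1)]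
  have B': "zero_fan k y z w'" "alternate l z' w' = alternate k z w'"
    using B(1) uniq by (auto simp: zero_fan_def alternate_def)
  let ?G = "graph (alternate k z w)" and ?H = "graph (alternate k z w')"
  have dom: "blowup\<^sup>*\<^sup>* ?G \<Gamma>"
    using good_alternate[OF A(1)] alternate_real[OF A(1)] by (rule good_dominated)
  have isoB: "wgraph_iso g B ?H" using B(2) B'(2) by simp
  \<comment> \<open>Each left move raises the parameter by 1. For negative \<open>s\<close> the left
    moves lead from the graph of \<open>B\<close> to that of \<open>A\<close> and are then
    reversed.\<close>
  define s where "s = y - x"
  have "equals_move_power s \<Gamma> gs f A g B \<and> (\<exists>n. (step elementary ^^ n) ?G ?H)"
  proof (cases "x \<le> y")
    case True
    then have "zero_fan k (x + int (nat \<bar>s\<bar>)) z w'" using B'(1) by (simp add: s_def)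
    then have "(step (left_move gs) ^^ nat \<bar>s\<bar>) ?G ?H" "(step elementary)\<^sup>*\<^sup>* ?G ?H"
      using move_power[OF A(1)] by blast+
    then show ?thesis
      using composition_ofI[where R = left_move, OF _ dom A(2) isoB] True
        rtranclp_imp_relpowp[of "step elementary" ?G ?H]
      by (simp add: equals_move_power_def s_def)
  next
    case False
    then have "zero_fan k (y + int (nat \<bar>s\<bar>)) z w" using A(1) by (simp add: s_def)
    then have *: "(step (left_move gs) ^^ nat \<bar>s\<bar>) ?H ?G" "(step elementary)\<^sup>*\<^sup>* ?H ?G"
      using move_power[OF B'(1)] by blast+
    have "(step (right_move gs) ^^ nat \<bar>s\<bar>) ?G ?H"
      by (rule step_converse[OF _ *(1)]) (simp add: right_move_def)
    then have "equals_move_power s \<Gamma> gs f A g B"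
      using composition_ofI[where R = right_move, OF _ dom A(2) isoB] False
      by (simp add: equals_move_power_def s_def)
    moreover obtain n where "(step elementary ^^ n) ?H ?G"
      using *(2) by (blast dest: rtranclp_imp_relpowp)
    then have "(step elementary ^^ n) ?G ?H"
      by (rule step_converse[where R = elementary, rotated]) (rule elementary.inverse)
    ultimately show ?thesis by blast
  qed
  then show ?thesis
    using uniq(1) composition_ofI[where R = "\<lambda>_. elementary", OF _ dom A(2) isoB]
    unfolding composition_of_elementary_def by blast
qed

end
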